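(* Let $F$ be a field of characteristic $p$, let $K/F$ be a purely inseparable field extension of exponent one, and let $\delta$ be an algebraic derivation on $K$ with ${\rm Const}(\delta)=F$ and minimum polynomial $g(t)=t^{p^e}+c_1t^{p^{e-1}}+\dots+c_et\in F[t]$. Let $R=K[t;\delta]$ and $x=g(t)$, and let $N$ be the reduced norm of the central simple $F(x)$-algebra $K(t;\delta)$. Let $f\in R$ be a polynomial of degree $m$, let $h(t)=\hat h(g(t))$ with $\hat h\in F[x]$ monic be its minimal central left multiple, and suppose that $\deg(\hat h)=m$ (degree in $x$). (i) If $\hat h$ is irreducible in $F[x]$, then $f$ is irreducible in $R$. (ii) If $f$ is irreducible in $R$, then $N(f)$ is irreducible in $F[x]$.
   Context: ${\rm Const}(\delta)=\{a\in K:\delta(a)=0\}$. $K[t;\delta]$ is the ring of polynomials $\sum a_it^i$, $a_i\in K$, with $ta=at+\delta(a)$ for $a\in K$. Its center is $C(R)=F[x]$, $x=g(t)$. The ring of central quotients $K(t;\delta)=\{f/q: f\in R,\ 0\neq q\in F[x]\}$ is a central simple algebra of degree $p^e$ over $F(x)$; $N$ is its reduced norm, and $N(f)\in F[x]$ for $f\in R$. An element $f\in R$ is irreducible if it is not a unit and is not a product $qr$ with $q,r\in R$ and $1\le\deg q,\deg r<\deg f$. The minimal central left multiple of $f\ne0$ is the unique polynomial $h\in C(R)$ of minimal degree such that $h=qf$ for some $q\in R$ and $h(t)=\hat h(g(t))$ with $\hat h\in F[x]$ monic. *)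

theory Defs
  imports
    "HOL-Library.FuncSet"
    "HOL-Algebra.Algebraic_Closure_Type"
    "HOL-Computational_Algebra.Computational_Algebra"
    "Jordan_Normal_Form.Matrix"
    "Jordan_Normal_Form.Determinant"
begin

section \<open>Inseparable extensions and derivations\<close>

text \<open>A field extension $K/F$ is a field homomorphism \<open>\<iota> :: 'f \<Rightarrow> 'k\<close>; the subfield $F$ of $K$
  is the range of \<open>\<iota>\<close>.  The exponent of a purely inseparable extension in characteristic $p$ is the
  least $n$ with $K^{p^n} \subseteq F$; exponent one thus means $K^p \subseteq F \neq K$.\<close>

definition purely_inseparable_exponent ::
    "nat \<Rightarrow> ('f::field \<Rightarrow> 'k::field) \<Rightarrow> nat \<Rightarrow> bool" where
  "purely_inseparable_exponent p \<iota> n \<longleftrightarrow>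
     (\<forall>a. a ^ (p ^ n) \<in> range \<iota>) \<and> (\<forall>k<n. \<not> (\<forall>a. a ^ (p ^ k) \<in> range \<iota>))"

definition derivation :: "('k::comm_ring \<Rightarrow> 'k) \<Rightarrow> bool" where
  "derivation \<delta> \<longleftrightarrow>
     (\<forall>a b. \<delta> (a + b) = \<delta> a + \<delta> b) \<and> (\<forall>a b. \<delta> (a * b) = a * \<delta> b + \<delta> a * b)"

definition Const :: "('k::zero \<Rightarrow> 'k) \<Rightarrow> 'k set" where
  "Const \<delta> = {a. \<delta> a = 0}"

text \<open>The operator $q(\delta) = \sum_i q_i \delta^i$ on $K$.\<close>

definition poly_operator ::
    "('k \<Rightarrow> 'k) \<Rightarrow> ('f::comm_semiring_1 \<Rightarrow> 'k::comm_semiring_1) \<Rightarrow> 'f poly \<Rightarrow> 'k \<Rightarrow> 'k" where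
  "poly_operator \<delta> \<iota> q a =
     (\<Sum>i\<le>Polynomial.degree q. \<iota> (Polynomial.coeff q i) * (\<delta> ^^ i) a)"

text \<open>That a minimum polynomial exists is what it means for \<open>\<delta>\<close> to be algebraic.\<close>

definition is_minimum_polynomial ::
    "('k \<Rightarrow> 'k) \<Rightarrow> ('f::field \<Rightarrow> 'k::field) \<Rightarrow> 'f poly \<Rightarrow> bool" where
  "is_minimum_polynomial \<delta> \<iota> g \<longleftrightarrow>
     lead_coeff g = 1 \<and> (\<forall>a. poly_operator \<delta> \<iota> g a = 0) \<and>
     (\<forall>q. q \<noteq> 0 \<longrightarrow> (\<forall>a. poly_operator \<delta> \<iota> q a = 0) \<longrightarrow>
        Polynomial.degree g \<le> Polynomial.degree q)"


section \<open>The differential polynomial ring $K[t;\delta]$\<close>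

text \<open>An element $\sum_i a_i t^i$ (coefficients on the left) is represented by the polynomial with
  coefficients $a_i$.  The rule $ta = at + \delta(a)$ gives
  $t \cdot \sum_j b_j t^j = \sum_j b_j t^{j+1} + \sum_j \delta(b_j) t^j$, which determines the product.\<close>

definition t_times :: "('k::field \<Rightarrow> 'k) \<Rightarrow> 'k poly \<Rightarrow> 'k poly" where
  "t_times \<delta> f = pCons 0 f + map_poly \<delta> f"

definition diff_mult :: "('k::field \<Rightarrow> 'k) \<Rightarrow> 'k poly \<Rightarrow> 'k poly \<Rightarrow> 'k poly" where
  "diff_mult \<delta> f g =
     (\<Sum>i\<le>Polynomial.degree f. Polynomial.smult (Polynomial.coeff f i) ((t_times \<delta> ^^ i) g))"

definition diff_poly_ring :: "('k::field \<Rightarrow> 'k) \<Rightarrow> 'k poly ring" where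
  "diff_poly_ring \<delta> =
     \<lparr>carrier = UNIV, monoid.mult = diff_mult \<delta>, one = 1, ring.zero = 0, add = (+)\<rparr>"

lemma diff_mult_t_const:
  assumes "\<delta> 0 = 0"
  shows "diff_mult \<delta> [:0, 1:] [:a:] = [:\<delta> a, a:]"
  using assms by (simp add: diff_mult_def t_times_def map_poly_pCons)

definition center :: "('a, 'm) ring_scheme \<Rightarrow> 'a set" where
  "center R = {z \<in> carrier R. \<forall>y\<in>carrier R. z \<otimes>\<^bsub>R\<^esub> y = y \<otimes>\<^bsub>R\<^esub> z}"

definition diff_irreducible :: "('k::field \<Rightarrow> 'k) \<Rightarrow> 'k poly \<Rightarrow> bool" where
  "diff_irreducible \<delta> f \<longleftrightarrow>
     f \<notin> Units (diff_poly_ring \<delta>) \<and>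
     \<not> (\<exists>q r. f = q \<otimes>\<^bsub>diff_poly_ring \<delta>\<^esub> r \<and>
          1 \<le> Polynomial.degree q \<and> Polynomial.degree q < Polynomial.degree f \<and>
          1 \<le> Polynomial.degree r \<and> Polynomial.degree r < Polynomial.degree f)"

text \<open>For $q \in F[x]$, the element $q(g(t))$ of $K[t;\delta]$.\<close>

definition at_g ::
    "('k \<Rightarrow> 'k) \<Rightarrow> ('f::field \<Rightarrow> 'k::field) \<Rightarrow> 'f poly \<Rightarrow> 'f poly \<Rightarrow> 'k poly" where
  "at_g \<delta> \<iota> g q =
     (\<Sum>i\<le>Polynomial.degree q.
        Polynomial.smult (\<iota> (Polynomial.coeff q i)) (map_poly \<iota> g [^]\<^bsub>diff_poly_ring \<delta>\<^esub> i))"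

definition is_min_central_left_multiple :: "('k::field \<Rightarrow> 'k) \<Rightarrow> 'k poly \<Rightarrow> 'k poly \<Rightarrow> bool" where
  "is_min_central_left_multiple \<delta> f h \<longleftrightarrow>
     (let R = diff_poly_ring \<delta>;
          central_multiple = (\<lambda>h. h \<in> center R \<and> h \<noteq> 0 \<and> (\<exists>q\<in>carrier R. h = q \<otimes>\<^bsub>R\<^esub> f))
      in central_multiple h \<and>
         (\<forall>h'. central_multiple h' \<longrightarrow> Polynomial.degree h \<le> Polynomial.degree h'))"


section \<open>The ring of central quotients $K(t;\delta)$\<close>

text \<open>The fraction $f/q$ with $f \in K[t;\delta]$ and $0 \neq q \in F[x]$ is the class of \<open>(f, q)\<close>,
  where $f/q = f'/q'$ iff $f \cdot q'(g(t)) = f' \cdot q(g(t))$.\<close>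

definition cq_rel ::
    "('k \<Rightarrow> 'k) \<Rightarrow> ('f::field \<Rightarrow> 'k::field) \<Rightarrow> 'f poly \<Rightarrow>
     (('k poly \<times> 'f poly) \<times> ('k poly \<times> 'f poly)) set" where
  "cq_rel \<delta> \<iota> g =
     {((f, q), (f', q')). q \<noteq> 0 \<and> q' \<noteq> 0 \<and>
        f \<otimes>\<^bsub>diff_poly_ring \<delta>\<^esub> at_g \<delta> \<iota> g q' = f' \<otimes>\<^bsub>diff_poly_ring \<delta>\<^esub> at_g \<delta> \<iota> g q}"

definition cq_frac ::
    "('k \<Rightarrow> 'k) \<Rightarrow> ('f::field \<Rightarrow> 'k::field) \<Rightarrow> 'f poly \<Rightarrow> 'k poly \<Rightarrow> 'f poly \<Rightarrow>
     ('k poly \<times> 'f poly) set" where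
  "cq_frac \<delta> \<iota> g f q = cq_rel \<delta> \<iota> g `` {(f, q)}"

definition central_quotients ::
    "('k \<Rightarrow> 'k) \<Rightarrow> ('f::field \<Rightarrow> 'k::field) \<Rightarrow> 'f poly \<Rightarrow> ('k poly \<times> 'f poly) set ring" where
  "central_quotients \<delta> \<iota> g =
     \<lparr>carrier = {cq_frac \<delta> \<iota> g f q | f q. q \<noteq> 0},
      monoid.mult = (\<lambda>A B. \<Union>(f, q)\<in>A. \<Union>(f', q')\<in>B.
        cq_frac \<delta> \<iota> g (f \<otimes>\<^bsub>diff_poly_ring \<delta>\<^esub> f') (q * q')),
      one = cq_frac \<delta> \<iota> g 1 1,
      ring.zero = cq_frac \<delta> \<iota> g 0 1,
      add = (\<lambda>A B. \<Union>(f, q)\<in>A. \<Union>(f', q')\<in>B.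
        cq_frac \<delta> \<iota> g
          (f \<otimes>\<^bsub>diff_poly_ring \<delta>\<^esub> at_g \<delta> \<iota> g q' + f' \<otimes>\<^bsub>diff_poly_ring \<delta>\<^esub> at_g \<delta> \<iota> g q)
          (q * q'))\<rparr>"

text \<open>The embedding $F(x) \to K(t;\delta)$, $a/b \mapsto a(g(t))/b$; the union ranges over all
  representations $a/b$ of the given rational function, which all yield the same class.\<close>

definition cq_scalar ::
    "('k \<Rightarrow> 'k) \<Rightarrow> ('f::field \<Rightarrow> 'k::field) \<Rightarrow> 'f poly \<Rightarrow> 'f poly fract \<Rightarrow>
     ('k poly \<times> 'f poly) set" where
  "cq_scalar \<delta> \<iota> g z =
     (\<Union>(a, b)\<in>{(a, b). b \<noteq> 0 \<and> z = Fraction_Field.Fract a b}. cq_frac \<delta> \<iota> g (at_g \<delta> \<iota> g a) b)"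


section \<open>Reduced norm of a central simple algebra\<close>

text \<open>\<open>b 0, \<dots>, b (d - 1)\<close> is a basis of \<open>V\<close> over the field \<open>'z\<close> acting through \<open>sm\<close>.\<close>

definition is_basis ::
    "('v, 'm) ring_scheme \<Rightarrow> ('z \<Rightarrow> 'v \<Rightarrow> 'v) \<Rightarrow> nat \<Rightarrow> (nat \<Rightarrow> 'v) \<Rightarrow> bool" where
  "is_basis V sm d b \<longleftrightarrow>
     b \<in> {..<d} \<rightarrow> carrier V \<and>
     (\<forall>v\<in>carrier V. \<exists>!c. c \<in> {..<d} \<rightarrow>\<^sub>E UNIV \<and> v = (\<Oplus>\<^bsub>V\<^esub>i\<in>{..<d}. sm (c i) (b i)))"

text \<open>Let \<open>A\<close> be an algebra over the field $Z$ with structure map \<open>s\<close>, and let $E$ be an algebraic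
  closure of $Z$.  A $Z$-algebra homomorphism $\varphi : A \to M_n(E)$ corresponds to the $E$-algebra
  homomorphism $A \otimes_Z E \to M_n(E)$, $a \otimes \lambda \mapsto \lambda\varphi(a)$.  The latter
  is an isomorphism with $\dim_Z A = n^2$ iff $\varphi$ sends some $Z$-basis of \<open>A\<close> with $n^2$
  elements to an $E$-basis of $M_n(E)$.\<close>

definition is_splitting ::
    "('a, 'm) ring_scheme \<Rightarrow> ('z::field \<Rightarrow> 'a) \<Rightarrow> nat \<Rightarrow> ('a \<Rightarrow> 'z alg_closure mat) \<Rightarrow> bool" where
  "is_splitting A s n \<phi> \<longleftrightarrow>
     \<phi> \<in> Ring.ring_hom A (ring_mat TYPE('z alg_closure) n ()) \<and>
     (\<forall>z. \<phi> (s z) = to_ac z \<cdot>\<^sub>m 1\<^sub>m n) \<and>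
     (\<exists>b. is_basis A (\<lambda>z a. s z \<otimes>\<^bsub>A\<^esub> a) (n\<^sup>2) b \<and>
          is_basis (ring_mat TYPE('z alg_closure) n ()) (\<cdot>\<^sub>m) (n\<^sup>2) (\<lambda>i. \<phi> (b i)))"

text \<open>The reduced norm of a central simple $Z$-algebra of degree \<open>n\<close>:
  $a \mapsto \det(\varphi(a \otimes 1)) \in Z$ for an isomorphism
  $\varphi : A \otimes_Z E \to M_n(E)$.  It does not depend on $\varphi$.\<close>

definition is_reduced_norm ::
    "('a, 'm) ring_scheme \<Rightarrow> ('z::field \<Rightarrow> 'a) \<Rightarrow> nat \<Rightarrow> ('a \<Rightarrow> 'z) \<Rightarrow> bool" where
  "is_reduced_norm A s n N \<longleftrightarrow>
     (\<exists>\<phi>. is_splitting A s n \<phi> \<and> (\<forall>a\<in>carrier A. det (\<phi> a) = to_ac (N a)))"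

end

theory Submission
  imports Defs
begin

text \<open>The norm $N(f)$ of $f \in R$ is a polynomial in $x$ of degree at most $\deg f$: since
  $K^p \subseteq F$, all powers $f^k$ lie in one finitely generated $F[x]$-submodule of $R$, with
  coefficients of degree at most $k \deg f / p^e$ in $x$, so expanding the determinant bounds the
  denominators of $N(f)^k = N(f^k)$ independently of $k$, and the degrees of these powers by
  $k \deg f$ up to a constant.  If $h = qf$ and $\deg \hat h = \deg f = m$, then
  $N(q) N(f) = \hat h^{p^e}$ has degree $p^e m$, which forces $\deg N(f) = m$.  So if $\hat h$ is irreducible, then $N(f)$ equals $\hat h$
  up to a unit, and a factorization of $f$ would give one of $N(f)$ with the same degrees.
  Conversely, $R$ has right division, so for irreducible $f$ and $\hat h = ab$ the left ideal
  $Ra + Rf$ is $Rf$ or $R$, hence $f$ right-divides $a$ or $b$; as $\hat h$ is minimal, it is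
  irreducible.\<close>

section \<open>Arithmetic in the differential polynomial ring\<close>

locale derivation_ring =
  fixes \<delta> :: "'k::field \<Rightarrow> 'k"
  assumes derivation: "derivation \<delta>"
begin

abbreviation tm :: "'k poly \<Rightarrow> 'k poly" where "tm \<equiv> t_times \<delta>"

abbreviation skew_mult :: "'k poly \<Rightarrow> 'k poly \<Rightarrow> 'k poly" (infixl "\<star>" 70) where
  "f \<star> g \<equiv> diff_mult \<delta> f g"

lemma der_add: "\<delta> (a + b) = \<delta> a + \<delta> b"
  and der_mult: "\<delta> (a * b) = a * \<delta> b + \<delta> a * b"
  using derivation by (auto simp: derivation_def)

lemma der_0 [simp]: "\<delta> 0 = 0"
  using der_add[of 0 0] by (metis add_cancel_right_left add.right_neutral)

lemma der_1 [simp]: "\<delta> 1 = 0"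
  using der_mult[of 1 1] by (metis add_cancel_right_left mult_1 mult.right_neutral)

lemma coeff_tm: "coeff (tm f) n = (case n of 0 \<Rightarrow> 0 | Suc k \<Rightarrow> coeff f k) + \<delta> (coeff f n)"
  by (auto simp: t_times_def coeff_map_poly coeff_pCons split: nat.split)

lemma tm_0 [simp]: "tm 0 = 0"
  by (simp add: t_times_def)

lemma tm_add: "tm (f + g) = tm f + tm g"
  by (rule poly_eqI) (simp add: coeff_tm der_add split: nat.split)

lemma tm_smult: "tm (smult a f) = smult a (tm f) + smult (\<delta> a) f"
  by (rule poly_eqI) (simp add: coeff_tm der_mult algebra_simps split: nat.split)

lemma tm_sum: "tm (\<Sum>i\<in>A. f i) = (\<Sum>i\<in>A. tm (f i))"
  by (induction A rule: infinite_finite_induct) (auto simp: tm_add)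

lemma tm_funpow_0 [simp]: "(tm ^^ i) 0 = 0"
  by (induction i) auto

lemma tm_funpow_add: "(tm ^^ i) (f + g) = (tm ^^ i) f + (tm ^^ i) g"
  by (induction i) (auto simp: tm_add)

lemma tm_funpow_one: "(tm ^^ i) 1 = monom 1 i"
proof (induction i)
  case (Suc i)
  have "tm (monom 1 i) = monom 1 (Suc i)"
    by (rule poly_eqI) (auto simp: coeff_tm split: nat.split)
  with Suc show ?case by simp
qed auto

lemma tm_funpow_smult_const:
  assumes "\<delta> a = 0"
  shows "(tm ^^ i) (smult a f) = smult a ((tm ^^ i) f)"
  by (induction i) (auto simp: tm_smult assms)

text \<open>Any bound \<open>n\<close> on the degree may replace the degree itself, so that products
  with different left factors can be added over one common range of summation.\<close>

lemma skew_mult_eq_sum: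
  assumes "degree f \<le> n"
  shows "f \<star> g = (\<Sum>i\<le>n. smult (coeff f i) ((tm ^^ i) g))"
  unfolding diff_mult_def using assms
  by (intro sum.mono_neutral_left) (auto simp: coeff_eq_0)

lemma skew_add_left: "(f + g) \<star> h = f \<star> h + g \<star> h"
proof -
  let ?n = "max (degree f) (degree g)"
  have "degree (f + g) \<le> ?n" by (rule degree_add_le_max)
  then show ?thesis
    by (simp add: skew_mult_eq_sum[of _ ?n] smult_add_left sum.distrib)
qed

lemma skew_add_right: "f \<star> (g + h) = f \<star> g + f \<star> h"
  by (simp add: diff_mult_def tm_funpow_add smult_add_right sum.distrib)

lemma smult_sum_right: "smult a (\<Sum>i\<in>A. f i) = (\<Sum>i\<in>A. smult a (f i))"
  by (induction A rule: infinite_finite_induct) (auto simp: smult_add_right)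

lemma skew_smult_left: "smult a f \<star> g = smult a (f \<star> g)"
  by (simp add: skew_mult_eq_sum[of _ "degree f"] degree_smult_le smult_sum_right)

lemma skew_0_left [simp]: "0 \<star> g = 0"
  and skew_0_right [simp]: "f \<star> 0 = 0"
  by (simp_all add: diff_mult_def)

lemma skew_sum_left: "(\<Sum>i\<in>A. f i) \<star> g = (\<Sum>i\<in>A. f i \<star> g)"
  by (induction A rule: infinite_finite_induct) (auto simp: skew_add_left)

lemma skew_sum_right: "g \<star> (\<Sum>i\<in>A. f i) = (\<Sum>i\<in>A. g \<star> f i)"
  by (induction A rule: infinite_finite_induct) (auto simp: skew_add_right)

lemma skew_diff_left: "(f - g) \<star> h = f \<star> h - g \<star> h"
  using skew_add_left[of "f - g" g h] by (simp add: algebra_simps)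

lemma skew_monom_left: "monom a i \<star> g = smult a ((tm ^^ i) g)"
proof -
  have "monom a i \<star> g = (\<Sum>j\<le>i. smult (coeff (monom a i) j) ((tm ^^ j) g))"
    by (rule skew_mult_eq_sum) (rule degree_monom_le)
  also have "\<dots> = (\<Sum>j\<in>{i}. smult (coeff (monom a i) j) ((tm ^^ j) g))"
    by (rule sum.mono_neutral_right) auto
  finally show ?thesis by simp
qed

lemma skew_const_left: "[:a:] \<star> g = smult a g"
  using skew_monom_left[of a 0 g] by (simp add: monom_0)

lemma skew_1_left [simp]: "1 \<star> g = g"
  using skew_const_left[of 1 g] by (simp add: one_pCons)

lemma skew_1_right [simp]: "f \<star> 1 = f"
  by (simp add: diff_mult_def tm_funpow_one smult_monom poly_as_sum_of_monoms)

text \<open>This is associativity with left factor t. A coefficient of \<open>tm f\<close> is a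
  shifted coefficient of \<open>f\<close> plus a derivative of one, and these two parts match the
  two terms in \<open>tm_smult\<close>. General associativity follows by iteration and by
  K-linearity in the left factor.\<close>

lemma skew_tm_left: "tm f \<star> g = tm (f \<star> g)"
proof -
  have "degree (tm f) \<le> Suc (degree f)"
    by (rule degree_le) (auto simp: coeff_tm coeff_eq_0 split: nat.split)
  then have "tm f \<star> g = (\<Sum>i\<le>Suc (degree f). smult (coeff (tm f) i) ((tm ^^ i) g))"
    by (rule skew_mult_eq_sum)
  also have "\<dots> = (\<Sum>i\<le>Suc (degree f). smult (case i of 0 \<Rightarrow> 0 | Suc k \<Rightarrow> coeff f k) ((tm ^^ i) g))
      + (\<Sum>i\<le>Suc (degree f). smult (\<delta> (coeff f i)) ((tm ^^ i) g))"
    by (simp add: coeff_tm smult_add_left sum.distrib del: sum.atMost_Suc)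
  also have "(\<Sum>i\<le>Suc (degree f). smult (case i of 0 \<Rightarrow> 0 | Suc k \<Rightarrow> coeff f k) ((tm ^^ i) g))
      = (\<Sum>i\<le>degree f. smult (coeff f i) ((tm ^^ Suc i) g))"
    by (subst sum.atMost_Suc_shift) simp
  also have "(\<Sum>i\<le>Suc (degree f). smult (\<delta> (coeff f i)) ((tm ^^ i) g))
      = (\<Sum>i\<le>degree f. smult (\<delta> (coeff f i)) ((tm ^^ i) g))"
    by (simp add: coeff_eq_0)
  finally show ?thesis
    by (simp add: diff_mult_def tm_sum tm_smult sum.distrib)
qed

lemma skew_tm_funpow_left: "(tm ^^ i) f \<star> g = (tm ^^ i) (f \<star> g)"
  by (induction i) (auto simp: skew_tm_left)

lemma skew_assoc: "f \<star> g \<star> h = f \<star> (g \<star> h)"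
  unfolding diff_mult_def[of \<delta> f] 
  by (simp add: skew_sum_left skew_smult_left skew_tm_funpow_left)

section \<open>Degrees, leading coefficients and right division\<close>

lemma tm_degree_lead_coeff:
  assumes "f \<noteq> 0"
  shows "degree (tm f) = Suc (degree f)" and "lead_coeff (tm f) = lead_coeff f"
proof -
  have "degree (tm f) \<le> Suc (degree f)"
    by (rule degree_le) (auto simp: coeff_tm coeff_eq_0 split: nat.split)
  moreover have *: "coeff (tm f) (Suc (degree f)) = lead_coeff f"
    by (simp add: coeff_tm coeff_eq_0)
  ultimately show "degree (tm f) = Suc (degree f)"
    using assms by (metis le_antisym le_degree leading_coeff_0_iff)
  then show "lead_coeff (tm f) = lead_coeff f"
    using * by simp
qed

lemma tm_funpow_degree_lead_coeff:
  assumes "f \<noteq> 0"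
  shows "degree ((tm ^^ i) f) = i + degree f \<and> lead_coeff ((tm ^^ i) f) = lead_coeff f"
proof (induction i)
  case (Suc i)
  then have "(tm ^^ i) f \<noteq> 0" using assms by auto
  with Suc show ?case using tm_degree_lead_coeff[of "(tm ^^ i) f"] by auto
qed auto

lemma degree_tm_funpow_le: "degree ((tm ^^ i) f) \<le> i + degree f"
  using tm_funpow_degree_lead_coeff[of f i] by (cases "f = 0") auto

lemma degree_skew_mult_le: "degree (f \<star> g) \<le> degree f + degree g"
  unfolding diff_mult_def
  by (intro degree_sum_le)
    (auto intro: order.trans[OF degree_smult_le] order.trans[OF degree_tm_funpow_le])

lemma coeff_skew_mult_top:
  "coeff (f \<star> g) (degree f + degree g) = lead_coeff f * lead_coeff g"
proof (cases "g = 0")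
  case False
  have "coeff (f \<star> g) (degree f + degree g)
      = (\<Sum>i\<le>degree f. coeff f i * coeff ((tm ^^ i) g) (degree f + degree g))"
    by (simp add: diff_mult_def coeff_sum)
  also have "\<dots> = (\<Sum>i\<in>{degree f}. coeff f i * coeff ((tm ^^ i) g) (degree f + degree g))"
    by (rule sum.mono_neutral_right)
      (auto intro!: coeff_eq_0 le_less_trans[OF degree_tm_funpow_le])
  also have "\<dots> = lead_coeff f * lead_coeff g"
    using tm_funpow_degree_lead_coeff[OF False, of "degree f"] by auto
  finally show ?thesis .
qed auto

lemma degree_skew_mult:
  assumes "f \<noteq> 0" "g \<noteq> 0"
  shows "degree (f \<star> g) = degree f + degree g"
proof (rule antisym[OF degree_skew_mult_le])
  show "degree f + degree g \<le> degree (f \<star> g)"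
    by (rule le_degree) (use assms in \<open>simp add: coeff_skew_mult_top\<close>)
qed

lemma lead_coeff_skew_mult: "lead_coeff (f \<star> g) = lead_coeff f * lead_coeff g"
  by (cases "f = 0 \<or> g = 0") (auto simp: degree_skew_mult coeff_skew_mult_top)

lemma skew_mult_eq_0_iff [simp]: "f \<star> g = 0 \<longleftrightarrow> f = 0 \<or> g = 0"
  by (metis lead_coeff_skew_mult leading_coeff_0_iff mult_eq_0_iff)

lemma skew_right_cancel: "f \<star> h = g \<star> h \<longleftrightarrow> f = g \<or> h = 0"
  using skew_mult_eq_0_iff[of "f - g" h] by (simp add: skew_diff_left del: skew_mult_eq_0_iff)

lemma right_division:
  assumes "d \<noteq> 0"
  shows "\<exists>q r. y = q \<star> d + r \<and> (r = 0 \<or> degree r < degree d)"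
proof (induction "degree y" arbitrary: y rule: less_induct)
  case less
  show ?case
  proof (cases "y = 0 \<or> degree y < degree d")
    case True
    then show ?thesis by (intro exI[of _ 0] exI[of _ y]) auto
  next
    case False
    \<comment> \<open>Left multiplication by a power of t keeps the leading coefficient of
      \<open>d\<close>, as \<delta> contributes only in lower degrees. So the ordinary quotient of
      leading terms cancels the top term of \<open>y\<close>.\<close>
    define c where "c = monom (lead_coeff y / lead_coeff d) (degree y - degree d)"
    have c: "c \<noteq> 0" "degree c = degree y - degree d" "lead_coeff c = lead_coeff y / lead_coeff d"
      using False assms by (auto simp: c_def degree_monom_eq)
    have top: "degree (c \<star> d) = degree y" "lead_coeff (c \<star> d) = lead_coeff y"
      using False assms degree_skew_mult[of c d] c lead_coeff_skew_mult[of c d] by auto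
    show ?thesis
    proof (cases "y - c \<star> d = 0")
      case True
      then show ?thesis by (intro exI[of _ c] exI[of _ 0]) auto
    next
      case ne: False
      have "degree (y - c \<star> d) \<le> degree y"
        using top by (intro degree_diff_le) auto
      moreover have "coeff (y - c \<star> d) (degree y) = 0"
        using top by simp
      ultimately have "degree (y - c \<star> d) < degree y"
        using ne by (metis eq_zero_or_degree_less)
      from less[OF this] obtain q r where
        "y - c \<star> d = q \<star> d + r" "r = 0 \<or> degree r < degree d" by blast
      then show ?thesis
        by (intro exI[of _ "q + c"] exI[of _ r]) (auto simp: skew_add_left algebra_simps)
    qed
  qed
qed

lemma pow_simps [simp]:
  "f [^]\<^bsub>diff_poly_ring \<delta>\<^esub> (0::nat) = 1"
  "f [^]\<^bsub>diff_poly_ring \<delta>\<^esub> Suc i = f [^]\<^bsub>diff_poly_ring \<delta>\<^esub> i \<star> f"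
  by (simp_all add: diff_poly_ring_def)

lemma diff_poly_ring_simps [simp]:
  "carrier (diff_poly_ring \<delta>) = UNIV" "f \<otimes>\<^bsub>diff_poly_ring \<delta>\<^esub> g = f \<star> g"
  "\<one>\<^bsub>diff_poly_ring \<delta>\<^esub> = 1"
  by (simp_all add: diff_poly_ring_def)

lemma in_center_iff: "z \<in> center (diff_poly_ring \<delta>) \<longleftrightarrow> (\<forall>y. z \<star> y = y \<star> z)"
  by (simp add: center_def)

lemma Units_iff: "f \<in> Units (diff_poly_ring \<delta>) \<longleftrightarrow> f \<noteq> 0 \<and> degree f = 0"
proof
  assume "f \<in> Units (diff_poly_ring \<delta>)"
  then obtain g where "g \<star> f = 1" by (auto simp: Units_def)
  then show "f \<noteq> 0 \<and> degree f = 0"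
    by (metis add_eq_0_iff_both_eq_0 degree_1 degree_skew_mult skew_0_left skew_0_right zero_neq_one)
next
  assume "f \<noteq> 0 \<and> degree f = 0"
  then obtain a where "f = [:a:]" "a \<noteq> 0" by (metis degree_0_id pCons_0_0 lead_coeff_pCons(2))
  then show "f \<in> Units (diff_poly_ring \<delta>)"
    by (auto simp: Units_def skew_const_left one_pCons intro!: exI[of _ "[:inverse a:]"])
qed

end

section \<open>The central subring $F[x]$\<close>

locale algebraic_derivation = derivation_ring \<delta>
  for \<delta> :: "'k::field \<Rightarrow> 'k" +
  fixes \<iota> :: "'f::field \<Rightarrow> 'k" and p e :: nat and c :: "nat \<Rightarrow> 'f" and g :: "'f poly"
  assumes prime_p: "prime p" and char_p: "CHAR('f) = p"
    and hom: "field_hom \<iota>"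
    and Const_eq: "Const \<delta> = range \<iota>"
    and g_eq: "g = monom 1 (p ^ e) + (\<Sum>i=1..e. monom (c i) (p ^ (e - i)))"
    and pth_power: "a ^ p \<in> range \<iota>"
    and min_poly: "is_minimum_polynomial \<delta> \<iota> g"
begin

sublocale \<iota>: field_hom \<iota> by (fact hom)

abbreviation n :: nat where "n \<equiv> p ^ e"
abbreviation G :: "'k poly" where "G \<equiv> map_poly \<iota> g"
abbreviation ev :: "'f poly \<Rightarrow> 'k poly" where "ev \<equiv> at_g \<delta> \<iota> g"

lemma n_pos: "n > 0"
  using prime_p by (simp add: prime_gt_0_nat)

lemma der_\<iota> [simp]: "\<delta> (\<iota> a) = 0"
  using Const_eq by (auto simp: Const_def)

lemma of_nat_p: "of_nat p = (0 :: 'k)"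
  by (metis \<iota>.hom_of_nat \<iota>.hom_zero char_p of_nat_CHAR)

lemma map_poly_\<iota>_add: "map_poly \<iota> (q + r) = map_poly \<iota> q + map_poly \<iota> r"
  by (rule poly_eqI) (simp add: coeff_map_poly \<iota>.hom_add)

lemma degree_g: "degree g = n"
\<comment> \<open>For \<open>e = 0\<close> truncated subtraction gives
  \<open>p ^ (e - 1) = p ^ e\<close>, and the strict inequality of the other case would
  fail.\<close>
proof (cases "e = 0")
  case True
  then show ?thesis by (simp add: g_eq degree_monom_eq)
next
  case False
  have "degree (\<Sum>i=1..e. monom (c i) (p ^ (e - i))) < degree (monom (1::'f) n)"
  proof (rule le_less_trans[of _ "p ^ (e - 1)"])
    have "p ^ (e - i) \<le> p ^ (e - 1)" if "i \<ge> 1" for i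
      using that prime_p by (intro power_increasing) (auto dest: prime_gt_0_nat)
    then show "degree (\<Sum>i=1..e. monom (c i) (p ^ (e - i))) \<le> p ^ (e - 1)"
      by (intro degree_sum_le) (auto intro: order.trans[OF degree_monom_le])
    show "p ^ (e - 1) < degree (monom (1::'f) n)"
      using prime_gt_1_nat[OF prime_p] False by (simp add: degree_monom_eq)
  qed
  then show ?thesis
    unfolding g_eq by (subst degree_add_eq_left) (auto simp: degree_monom_eq)
qed

lemma lead_coeff_g: "coeff g n = 1"
  using min_poly degree_g by (simp add: is_minimum_polynomial_def)

lemma degree_G: "degree G = n"
  by (simp add: degree_g degree_map_poly)

lemma coeff_G [simp]: "coeff G i = \<iota> (coeff g i)"
  by (simp add: coeff_map_poly)

lemma G_nonzero [simp]: "G \<noteq> 0"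
  using degree_G n_pos by auto

section \<open>p-polynomials in t and the centrality of g(t)\<close>

text \<open>Pascal's rule gives the step from \<open>N\<close> to \<open>Suc N\<close>. The maps
  \<open>D\<close> and \<open>d\<close> are arbitrary because the lemma is applied to the
  \<open>p ^ j\<close>-th iterates of \<open>tm\<close> and \<open>\<delta>\<close>.\<close>

lemma twisted_leibniz:
  fixes D :: "'k poly \<Rightarrow> 'k poly" and d :: "'k \<Rightarrow> 'k"
  assumes D_add: "\<And>y z. D (y + z) = D y + D z"
    and D_smult: "\<And>a y. D (smult a y) = smult a (D y) + smult (d a) y"
  shows "(D ^^ N) (smult a y)
    = (\<Sum>k\<le>N. of_nat (N choose k) * smult ((d ^^ k) a) ((D ^^ (N - k)) y))"
proof (induction N)
  case (Suc N)
  define h where "h i j = smult ((d ^^ i) a) ((D ^^ j) y)" for i j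
  have D_0: "D 0 = 0" using D_add[of 0 0] by (metis add_cancel_right_left add.right_neutral)
  have D_sum: "D (\<Sum>i\<in>A. f i) = (\<Sum>i\<in>A. D (f i))" for A :: "nat set" and f
    by (induction A rule: infinite_finite_induct) (auto simp: D_add D_0)
  have D_of_nat: "D (of_nat k * z) = of_nat k * D z" for k z
    by (induction k) (auto simp: D_add D_0 algebra_simps)
  have Dh: "D (h i j) = h i (Suc j) + h (Suc i) j" for i j
    by (simp add: h_def D_smult)
  have "(D ^^ Suc N) (smult a y) = D (\<Sum>k\<le>N. of_nat (N choose k) * h k (N - k))"
    using Suc by (simp add: h_def)
  also have "\<dots> = (\<Sum>k\<le>N. of_nat (N choose k) * h k (Suc N - k))
      + (\<Sum>k\<le>N. of_nat (N choose k) * h (Suc k) (N - k))"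
    by (simp add: D_sum D_of_nat Dh algebra_simps sum.distrib Suc_diff_le)
  \<comment> \<open>The summand added for \<open>k = Suc N\<close> has binomial coefficient 0. With
    it, splitting off \<open>k = 0\<close> leaves a sum over the same range as the second
    one.\<close>
  also have "(\<Sum>k\<le>N. of_nat (N choose k) * h k (Suc N - k))
      = (\<Sum>k\<le>Suc N. of_nat (N choose k) * h k (Suc N - k))"
    by (simp add: binomial_eq_0)
  also have "\<dots> = h 0 (Suc N) + (\<Sum>k\<le>N. of_nat (N choose Suc k) * h (Suc k) (N - k))"
    by (subst sum.atMost_Suc_shift) simp
  also have "\<dots> + (\<Sum>k\<le>N. of_nat (N choose k) * h (Suc k) (N - k))
      = (\<Sum>k\<le>Suc N. of_nat (Suc N choose k) * h k (Suc N - k))"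
    by (subst sum.atMost_Suc_shift) (simp add: algebra_simps sum.distrib)
  finally show ?case by (simp only: h_def)
qed auto

text \<open>In characteristic $p$ the $p$-th power of a map satisfying a twisted Leibniz rule satisfies
  one again, since the inner binomial coefficients vanish.\<close>

lemma tm_funpow_p_smult:
  "(tm ^^ (p ^ j)) (smult a y) = smult a ((tm ^^ (p ^ j)) y) + smult ((\<delta> ^^ (p ^ j)) a) y"
proof (induction j arbitrary: a y)
  case 0
  show ?case by (simp add: tm_smult)
next
  case (Suc j)
  define D d where "D = tm ^^ (p ^ j)" and "d = \<delta> ^^ (p ^ j)"
  have Dp: "D ^^ p = tm ^^ (p ^ Suc j)" and dp: "d ^^ p = \<delta> ^^ (p ^ Suc j)"
    by (simp_all add: D_def d_def funpow_mult mult.commute)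
  have van: "of_nat (p choose k) = (0 :: 'k poly)" if "k \<noteq> 0" "k < p" for k
  proof -
    have "p dvd p choose k" using dvd_choose_prime[of k p] that prime_p by auto
    then obtain r where "p choose k = p * r" by blast
    then show ?thesis by (simp add: of_nat_poly of_nat_p)
  qed
  have "(D ^^ p) (smult a y)
      = (\<Sum>k\<le>p. of_nat (p choose k) * smult ((d ^^ k) a) ((D ^^ (p - k)) y))"
    by (rule twisted_leibniz) (use Suc in \<open>auto simp: D_def d_def tm_funpow_add\<close>)
  also have "\<dots> = (\<Sum>k\<in>{0, p}. of_nat (p choose k) * smult ((d ^^ k) a) ((D ^^ (p - k)) y))"
    by (rule sum.mono_neutral_right) (auto simp: van)
  also have "\<dots> = smult a ((D ^^ p) y) + smult ((d ^^ p) a) y"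
    using prime_p by (simp add: prime_gt_0_nat)
  finally show ?case by (simp add: Dp dp)
qed

lemma poly_operator_eq_sum:
  assumes "degree q \<le> N"
  shows "poly_operator \<delta> \<iota> q a = (\<Sum>i\<le>N. \<iota> (coeff q i) * (\<delta> ^^ i) a)"
  unfolding poly_operator_def using assms
  by (intro sum.mono_neutral_left) (auto simp: coeff_eq_0)

lemma poly_operator_add:
  "poly_operator \<delta> \<iota> (q + r) a = poly_operator \<delta> \<iota> q a + poly_operator \<delta> \<iota> r a"
proof -
  let ?n = "max (degree q) (degree r)"
  have "degree (q + r) \<le> ?n" by (rule degree_add_le_max)
  then show ?thesis
    by (simp add: poly_operator_eq_sum[of _ ?n] \<iota>.hom_add algebra_simps sum.distrib)
qed

lemma poly_operator_monom: "poly_operator \<delta> \<iota> (monom b i) a = \<iota> b * (\<delta> ^^ i) a"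
proof -
  have "poly_operator \<delta> \<iota> (monom b i) a = (\<Sum>j\<le>i. \<iota> (coeff (monom b i) j) * (\<delta> ^^ j) a)"
    by (rule poly_operator_eq_sum) (rule degree_monom_le)
  also have "\<dots> = (\<Sum>j\<in>{i}. \<iota> (coeff (monom b i) j) * (\<delta> ^^ j) a)"
    by (rule sum.mono_neutral_right) auto
  finally show ?thesis by simp
qed

text \<open>For a $p$-polynomial $q$ this is $q(t) a = a q(t) + q(\delta)(a)$.\<close>

definition p_rule :: "'f poly \<Rightarrow> bool" where
  "p_rule q \<longleftrightarrow> (\<forall>a y. map_poly \<iota> q \<star> smult a y
     = smult a (map_poly \<iota> q \<star> y) + smult (poly_operator \<delta> \<iota> q a) y)"

lemma p_rule_add: "p_rule q \<Longrightarrow> p_rule r \<Longrightarrow> p_rule (q + r)"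
  by (simp add: p_rule_def map_poly_\<iota>_add skew_add_left poly_operator_add
      smult_add_left smult_add_right)

lemma p_rule_0: "p_rule 0"
  by (simp add: p_rule_def poly_operator_def)

lemma p_rule_sum: "(\<And>i. i \<in> A \<Longrightarrow> p_rule (f i)) \<Longrightarrow> p_rule (\<Sum>i\<in>A. f i)"
  by (induction A rule: infinite_finite_induct) (auto simp: p_rule_0 p_rule_add)

lemma p_rule_monom: "p_rule (monom b (p ^ j))"
  by (simp add: p_rule_def map_poly_monom skew_monom_left tm_funpow_p_smult
      poly_operator_monom smult_add_right mult.commute)

text \<open>Every term of \<open>g\<close> satisfies \<open>p_rule\<close>, hence so does
  \<open>g\<close>. The extra term \<open>smult (poly_operator \<delta> \<iota> g a) y\<close>
  vanishes because \<open>g\<close> is the minimum polynomial of \<delta>.\<close>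

lemma G_smult: "G \<star> smult a y = smult a (G \<star> y)"
proof -
  have "p_rule g"
    unfolding g_eq by (intro p_rule_add p_rule_sum p_rule_monom)
  then show ?thesis
    using min_poly by (simp add: p_rule_def is_minimum_polynomial_def)
qed

text \<open>The coefficients of \<open>g\<close> lie in F = Const(\<delta>), so t commutes with
  g(t). Together with \<open>G_smult\<close> this makes g(t) central, since K and t generate
  R.\<close>

lemma G_tm_funpow: "G \<star> (tm ^^ i) y = (tm ^^ i) (G \<star> y)"
proof (induction i)
  case (Suc i)
  have "G \<star> tm z = tm (G \<star> z)" for z
    by (simp add: diff_mult_def tm_sum tm_smult funpow_swap1)
  with Suc show ?case by simp
qed auto

lemma G_central: "G \<star> y = y \<star> G"
proof -
  have "G \<star> y = G \<star> (y \<star> 1)" by simp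
  also have "\<dots> = y \<star> G"
    unfolding diff_mult_def[of \<delta> y]
    by (simp add: skew_sum_right G_smult G_tm_funpow)
  finally show ?thesis .
qed

section \<open>The embedding of F[x] into the center of R\<close>

lemma ev_eq_sum:
  assumes "degree q \<le> N"
  shows "ev q = (\<Sum>i\<le>N. smult (\<iota> (coeff q i)) (G [^]\<^bsub>diff_poly_ring \<delta>\<^esub> i))"
  unfolding at_g_def using assms
  by (intro sum.mono_neutral_left) (auto simp: coeff_eq_0)

lemma ev_add: "ev (q + r) = ev q + ev r"
proof -
  let ?n = "max (degree q) (degree r)"
  have "degree (q + r) \<le> ?n" by (rule degree_add_le_max)
  then show ?thesis
    by (simp add: ev_eq_sum[of _ ?n] \<iota>.hom_add smult_add_left sum.distrib)
qed

lemma ev_0 [simp]: "ev 0 = 0"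
  by (simp add: at_g_def)

lemma ev_smult: "ev (smult a q) = smult (\<iota> a) (ev q)"
  by (simp add: ev_eq_sum[of _ "degree q"] degree_smult_le smult_sum_right \<iota>.hom_mult)

text \<open>Horner's rule; centrality, multiplicativity and the degree of \<open>ev\<close> are
  proved by induction along it.\<close>

lemma ev_pCons: "ev (pCons a q) = [:\<iota> a:] + ev q \<star> G"
proof -
  have "ev (pCons a q)
      = (\<Sum>i\<le>Suc (degree q). smult (\<iota> (coeff (pCons a q) i)) (G [^]\<^bsub>diff_poly_ring \<delta>\<^esub> i))"
    by (rule ev_eq_sum) (rule degree_pCons_le)
  then show ?thesis
    by (subst (asm) sum.atMost_Suc_shift)
      (simp add: at_g_def skew_sum_left skew_smult_left)
qed

lemma ev_1 [simp]: "ev 1 = 1"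
  by (simp add: one_pCons ev_pCons)

lemma const_central: "[:\<iota> a:] \<star> y = y \<star> [:\<iota> a:]"
proof -
  have "y \<star> smult (\<iota> a) z = smult (\<iota> a) (y \<star> z)" for z
    by (simp add: diff_mult_def tm_funpow_smult_const smult_sum_right mult.commute)
  from this[of 1] have "y \<star> [:\<iota> a:] = smult (\<iota> a) y" by simp
  then show ?thesis by (simp add: skew_const_left)
qed

lemma ev_central: "ev q \<star> y = y \<star> ev q"
proof (induction q arbitrary: y)
  case (pCons a q)
  have "ev q \<star> G \<star> y = y \<star> (ev q \<star> G)"
    by (metis G_central pCons.IH skew_assoc)
  then show ?case by (simp add: ev_pCons skew_add_left skew_add_right const_central)
qed auto

lemma ev_mult: "ev (q * r) = ev q \<star> ev r"
proof (induction q)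
  case (pCons a q)
  have "ev q \<star> ev r \<star> G = ev q \<star> G \<star> ev r"
    by (simp add: skew_assoc G_central)
  with pCons show ?case
    by (simp add: ev_add ev_smult ev_pCons skew_add_left skew_const_left)
qed auto

text \<open>In Horner's rule a nonzero multiple of \<open>G\<close> has degree at least
  \<open>n > 0\<close>, so adding a constant does not change its degree. Injectivity of
  \<open>ev\<close> is a consequence.\<close>

lemma degree_ev: "q \<noteq> 0 \<Longrightarrow> ev q \<noteq> 0 \<and> degree (ev q) = n * degree q"
proof (induction q)
  case (pCons a q)
  show ?case
  proof (cases "q = 0")
    case True
    with pCons show ?thesis by (simp add: ev_pCons)
  next
    case False
    with pCons have IH: "ev q \<noteq> 0" "degree (ev q) = n * degree q" by auto
    then have deg: "degree (ev q \<star> G) = n * Suc (degree q)"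
      by (simp add: degree_skew_mult degree_G)
    then have "degree [:\<iota> a:] < degree (ev q \<star> G)" using n_pos by simp
    then have *: "degree (ev (pCons a q)) = n * Suc (degree q)"
      unfolding ev_pCons by (subst degree_add_eq_right) (auto simp: deg)
    then have "ev (pCons a q) \<noteq> 0" using n_pos by auto
    with * False show ?thesis by simp
  qed
qed auto

lemma ev_eq_0_iff [simp]: "ev q = 0 \<longleftrightarrow> q = 0"
  using degree_ev by auto

end

section \<open>Elements of $F(x)$ whose powers have bounded denominators\<close>

text \<open>The entries of a splitting representation lie in an algebraic closure of F(x), which is
  therefore the target of this embedding of F[x].\<close>

definition emb :: "'f::field poly \<Rightarrow> 'f poly fract alg_closure" where
  "emb a = to_ac (to_fract a)"

lemma emb_simps [simp]:
  "emb 0 = 0" "emb 1 = 1" "emb (a + b) = emb a + emb b" "emb (a * b) = emb a * emb b"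
  "emb a = emb b \<longleftrightarrow> a = b"
  by (simp_all add: emb_def)

lemma emb_prod: "emb (\<Prod>i\<in>A. f i) = (\<Prod>i\<in>A. emb (f i))"
  by (induction A rule: infinite_finite_induct) auto

lemma to_fract_sum: "to_fract (\<Sum>i\<in>A. f i) = (\<Sum>i\<in>A. to_fract (f i))"
  by (induction A rule: infinite_finite_induct) auto

text \<open>The set {1} is linearly independent and extends to a basis of the closure over the base
  field, on which a linear functional can be prescribed. It brings relations whose constants lie in
  the closure down to F(x) and keeps their coefficients from F[x].\<close>

lemma alg_closure_retraction:
  obtains \<pi> :: "'z::field alg_closure \<Rightarrow> 'z"
  where "\<And>u v. \<pi> (u + v) = \<pi> u + \<pi> v" "\<And>a v. \<pi> (to_ac a * v) = a * \<pi> v" "\<pi> 1 = 1"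
proof -
  interpret vector_space_pair "\<lambda>(a::'z) v. to_ac a * v" "(*) :: 'z \<Rightarrow> 'z \<Rightarrow> 'z"
    by unfold_locales (auto simp: algebra_simps)
  have ind: "vs1.independent {1}"
    by simp
  interpret \<pi>: Vector_Spaces.linear "\<lambda>(a::'z) v. to_ac a * v" "(*) :: 'z \<Rightarrow> 'z \<Rightarrow> 'z"
    "construct {1} (\<lambda>_. 1)"
    by (rule linear_construct[OF ind])
  show ?thesis
    using that[of "construct {1} (\<lambda>_. 1)"] \<pi>.add \<pi>.scale construct_basis[OF ind] by auto
qed

lemma common_denominator:
  fixes z :: "'i \<Rightarrow> 'a::{idom} fract"
  assumes "finite S"
  shows "\<exists>D \<mu>. D \<noteq> 0 \<and> (\<forall>i\<in>S. to_fract D * z i = to_fract (\<mu> i))"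
  using assms
proof (induction S)
  case empty
  show ?case by (intro exI[of _ 1]) auto
next
  case (insert j S)
  then obtain D \<mu> where D: "D \<noteq> 0" "\<And>i. i \<in> S \<Longrightarrow> to_fract D * z i = to_fract (\<mu> i)"
    by blast
  obtain a b where ab: "z j = Fraction_Field.Fract a b" "b \<noteq> 0"
    by (cases "z j") auto
  have zj: "to_fract b * z j = to_fract a"
    using ab by (simp add: to_fract_def eq_fract)
  show ?case
  proof (intro exI[of _ "b * D"] exI[of _ "\<lambda>i. if i = j then D * a else b * \<mu> i"] conjI ballI)
    fix i assume "i \<in> insert j S"
    then show "to_fract (b * D) * z i = to_fract (if i = j then D * a else b * \<mu> i)"
      using zj D(2)[of i] by (auto simp: mult.assoc mult.left_commute)
  qed (use ab D in auto)
qed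

text \<open>The common denominators of all powers of $z$ form an ideal stable under multiplication by
  $z$; a generator $D$ of it divides $zD$.\<close>

lemma completely_integrally_closed:
  fixes z :: "'f::field poly fract"
  assumes "D \<noteq> 0" and "\<And>k. \<exists>E. to_fract D * z ^ k = to_fract E"
  shows "\<exists>P. z = to_fract P"
proof -
  define I where "I = {D. \<forall>k. \<exists>E. to_fract D * z ^ k = to_fract E}"
  define J where "J d \<longleftrightarrow> d \<in> I \<and> d \<noteq> 0" for d
  have "J D" using assms by (auto simp: J_def I_def)
  then obtain d where d: "d \<in> I" "d \<noteq> 0" and min: "\<And>r. r \<in> I \<Longrightarrow> r \<noteq> 0 \<Longrightarrow> degree d \<le> degree r"
    using ex_has_least_nat[of J D degree] by (auto simp: J_def)
  have I_diff: "x - q * y \<in> I" if xy: "x \<in> I" "y \<in> I" for x y q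
    unfolding I_def
  proof safe
    fix k
    obtain E1 E2 where "to_fract x * z ^ k = to_fract E1" "to_fract y * z ^ k = to_fract E2"
      using xy unfolding I_def by blast
    then have "to_fract (x - q * y) * z ^ k = to_fract (E1 - q * E2)"
      by (simp add: algebra_simps)
    then show "\<exists>E. to_fract (x - q * y) * z ^ k = to_fract E" by blast
  qed
  obtain d' where d': "to_fract d * z = to_fract d'"
    using d(1) by (auto simp: I_def dest: spec[of _ 1])
  have "d' \<in> I"
    unfolding I_def
  proof safe
    fix k
    have "to_fract d' * z ^ k = to_fract d * z ^ Suc k" by (simp add: d'[symmetric] mult.assoc)
    moreover have "\<exists>E. to_fract d * z ^ Suc k = to_fract E"
      using d(1) unfolding I_def by blast
    ultimately show "\<exists>E. to_fract d' * z ^ k = to_fract E" by (simp only:)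
  qed
  then have "d' - (d' div d) * d \<in> I" by (rule I_diff) (rule d)
  then have "d' mod d \<in> I" by (simp add: minus_div_mult_eq_mod)
  then have "d' mod d = 0"
    using min[of "d' mod d"] d degree_mod_less[of d d'] by (metis not_le)
  then have "d' = d * (d' div d)" by (metis add.right_neutral mult_div_mod_eq)
  then have "to_fract d * z = to_fract d * to_fract (d' div d)"
    using d' by (metis to_fract_mult)
  then show ?thesis using d by auto
qed

text \<open>The representations \<open>C k\<close> bound the denominator of $z^k$ independently of $k$, and its degree
  up to a constant by $km$.\<close>

lemma polynomial_of_bounded_powers:
  fixes z :: "'f::field poly fract"
  assumes fin: "finite S"
    and rep: "\<And>k. to_ac (z ^ k) = (\<Sum>s\<in>S. emb (C k s) * l s)"
    and deg: "\<And>k s. s \<in> S \<Longrightarrow> degree (C k s) \<le> k * m"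
  shows "\<exists>P. z = to_fract P \<and> degree P \<le> m"
proof -
  obtain \<pi> :: "'f poly fract alg_closure \<Rightarrow> 'f poly fract"
    where \<pi>: "\<And>u v. \<pi> (u + v) = \<pi> u + \<pi> v" "\<And>a v. \<pi> (to_ac a * v) = a * \<pi> v" "\<pi> 1 = 1"
    by (rule alg_closure_retraction) blast
  have \<pi>_0: "\<pi> 0 = 0" using \<pi>(2)[of 0 0] by simp
  have \<pi>_sum: "\<pi> (\<Sum>s\<in>A. f s) = (\<Sum>s\<in>A. \<pi> (f s))" for A f
    by (induction A rule: infinite_finite_induct) (auto simp: \<pi> \<pi>_0)
  have z_eq: "z ^ k = (\<Sum>s\<in>S. to_fract (C k s) * \<pi> (l s))" for k
  proof -
    \<comment> \<open>The factor 1 brings the argument into the form to which the linearity of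
      \<open>\<pi>\<close> applies.\<close>
    have "z ^ k = \<pi> (to_ac (z ^ k) * 1)" by (simp only: \<pi>) simp
    also have "\<dots> = (\<Sum>s\<in>S. to_fract (C k s) * \<pi> (l s))"
      by (simp only: mult_1_right rep \<pi>_sum) (simp add: \<pi> emb_def)
    finally show ?thesis .
  qed
  \<comment> \<open>The constants \<open>l\<close> do not depend on \<open>k\<close>, so one
    denominator serves all powers of \<open>z\<close>.\<close>
  obtain D \<mu> where D: "D \<noteq> 0" "\<And>s. s \<in> S \<Longrightarrow> to_fract D * \<pi> (l s) = to_fract (\<mu> s)"
    using common_denominator[OF fin, of "\<lambda>s. \<pi> (l s)"] by blast
  define E where "E k = (\<Sum>s\<in>S. C k s * \<mu> s)" for k
  have DE: "to_fract D * z ^ k = to_fract (E k)" for k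
    unfolding z_eq E_def to_fract_sum sum_distrib_left
    by (intro sum.cong) (simp_all add: D mult.left_commute)
  obtain P where zP: "z = to_fract P"
    using completely_integrally_closed[OF D(1)] DE by metis
  have "degree P \<le> m"
  proof (cases "P = 0")
    case False
    show ?thesis
    proof (rule ccontr)
      assume "\<not> degree P \<le> m"
      define B where "B = (\<Sum>s\<in>S. degree (\<mu> s))"
      have DP: "D * P ^ k = E k" for k
      proof -
        have "to_fract (P ^ k) = z ^ k" by (induction k) (auto simp: zP)
        then have "to_fract (D * P ^ k) = to_fract (E k)" using DE[of k] by simp
        then show ?thesis by (simp only: to_fract_eq_iff)
      qed
      have "degree D + k * degree P \<le> k * m + B" for k
      proof -
        have "degree D + k * degree P = degree (D * P ^ k)"
          using D False by (simp add: degree_mult_eq degree_power_eq)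
        also have "\<dots> = degree (E k)" by (simp add: DP)
        also have "\<dots> \<le> k * m + B"
          unfolding E_def
        proof (intro degree_sum_le fin)
          fix s assume s: "s \<in> S"
          have "degree (C k s * \<mu> s) \<le> degree (C k s) + degree (\<mu> s)"
            by (rule degree_mult_le)
          also have "\<dots> \<le> k * m + B"
            unfolding B_def by (intro add_mono deg s member_le_sum fin) auto
          finally show "degree (C k s * \<mu> s) \<le> k * m + B" .
        qed
        finally show ?thesis .
      qed
      \<comment> \<open>If \<open>degree P\<close> exceeds \<open>m\<close>, each further power
        gains at least 1 on the bound, so at \<open>k = Suc B\<close> the constant slack
        \<open>B\<close> is used up.\<close>
      from this[of "Suc B"] have "Suc B * degree P \<le> Suc B * m + B" by linarith
      moreover have "Suc B * Suc m \<le> Suc B * degree P"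
        using \<open>\<not> degree P \<le> m\<close> by (intro mult_le_mono2) simp
      ultimately show False by simp
    qed
  qed auto
  with zP show ?thesis by blast
qed

text \<open>The constants \<open>l\<close> must not depend on the coefficients \<open>b\<close>, which vary with the power of $f$.\<close>

lemma det_linear_combination:
  fixes B :: "'s \<Rightarrow> nat \<Rightarrow> nat \<Rightarrow> 'f::field poly fract alg_closure"
  assumes fin: "finite S"
  shows "\<exists>(Q :: ((nat \<Rightarrow> nat) \<times> (nat \<Rightarrow> 's)) set) l. finite Q \<and>
    (\<forall>b M d. M \<in> carrier_mat n n \<longrightarrow>
       (\<forall>i<n. \<forall>j<n. M $$ (i, j) = (\<Sum>s\<in>S. emb (b s) * B s i j)) \<longrightarrow>
       (\<forall>s\<in>S. n * degree (b s) \<le> d) \<longrightarrow>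
       (\<exists>C. det M = (\<Sum>q\<in>Q. emb (C q) * l q) \<and> (\<forall>q\<in>Q. degree (C q) \<le> d)))"
proof -
  \<comment> \<open>In the Leibniz formula every entry is a sum over \<open>S\<close>. Expanding the
    products leaves one term for each permutation \<open>\<sigma>\<close> and each choice
    \<open>\<rho>\<close> of a summand in every row.\<close>
  define Q where "Q = {\<sigma>. \<sigma> permutes {0..<n}} \<times> ({0..<n} \<rightarrow>\<^sub>E S)"
  define l where "l = (\<lambda>(\<sigma>, \<rho>). signof \<sigma> * (\<Prod>i=0..<n. B (\<rho> i) i (\<sigma> i)))"
  have fin_Q: "finite Q"
    unfolding Q_def by (intro finite_cartesian_product finite_permutations finite_PiE) (auto simp: fin)
  have expand: "\<exists>C. det M = (\<Sum>q\<in>Q. emb (C q) * l q) \<and> (\<forall>q\<in>Q. degree (C q) \<le> d)"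
    if M: "M \<in> carrier_mat n n"
      and ent: "\<forall>i<n. \<forall>j<n. M $$ (i, j) = (\<Sum>s\<in>S. emb (b s) * B s i j)"
      and deg: "\<forall>s\<in>S. n * degree (b s) \<le> d" for b M d
  proof (intro exI conjI ballI)
    let ?C = "\<lambda>q :: (nat \<Rightarrow> nat) \<times> (nat \<Rightarrow> 's). \<Prod>i=0..<n. b (snd q i)"
    have "det M = (\<Sum>\<sigma> | \<sigma> permutes {0..<n}. signof \<sigma> *
        (\<Prod>i=0..<n. \<Sum>s\<in>S. emb (b s) * B s i (\<sigma> i)))"
      unfolding det_def'[OF M]
      by (intro sum.cong arg_cong2[where f = "(*)"] prod.cong)
        (auto simp: ent dest: permutes_in_image)
    also have "\<dots> = (\<Sum>\<sigma> | \<sigma> permutes {0..<n}. signof \<sigma> *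
        (\<Sum>\<rho>\<in>{0..<n} \<rightarrow>\<^sub>E S. \<Prod>i=0..<n. emb (b (\<rho> i)) * B (\<rho> i) i (\<sigma> i)))"
      by (subst prod_sum_PiE) (auto simp: fin)
    also have "\<dots> = (\<Sum>\<sigma> | \<sigma> permutes {0..<n}. \<Sum>\<rho>\<in>{0..<n} \<rightarrow>\<^sub>E S.
        emb (?C (\<sigma>, \<rho>)) * l (\<sigma>, \<rho>))"
      by (simp add: sum_distrib_left l_def emb_prod prod.distrib mult_ac)
    also have "\<dots> = (\<Sum>q\<in>Q. emb (?C q) * l q)"
      unfolding Q_def by (simp add: sum.cartesian_product case_prod_unfold)
    finally show "det M = (\<Sum>q\<in>Q. emb (?C q) * l q)" .
    fix q assume "q \<in> Q"
    then have mem: "\<And>i. i < n \<Longrightarrow> snd q i \<in> S" by (auto simp: Q_def)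
    show "degree (?C q) \<le> d"
    proof (cases "n = 0")
      case False
      have "n * degree (?C q) \<le> n * (\<Sum>i=0..<n. degree (b (snd q i)))"
        using degree_prod_sum_le[of "{0..<n}" "\<lambda>i. b (snd q i)"] by (simp add: o_def)
      also have "\<dots> = (\<Sum>i=0..<n. n * degree (b (snd q i)))" by (simp add: sum_distrib_left)
      also have "\<dots> \<le> (\<Sum>i=0..<n. d)" using deg mem by (intro sum_mono) auto
      finally show ?thesis using False by simp
    qed simp
  qed
  show ?thesis
    by (intro exI[of _ Q] exI[of _ l] conjI fin_Q allI impI) (rule expand)
qed

text \<open>Each factor \<open>q\<close> of the power divides \<open>a\<close> or \<open>b\<close>
  and is cancelled there; \<open>k\<close> counts those cancelled from \<open>a\<close>. The lemma
  will be applied to the norm relation with right-hand side \<open>hhat ^ n\<close>.\<close>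

lemma prime_elem_power_factor:
  fixes q :: "'a::idom"
  assumes "prime_elem q" and "a * b = q ^ n"
  shows "\<exists>k u. u dvd 1 \<and> a = u * q ^ k"
  using assms(2)
proof (induction n arbitrary: a b)
  case 0
  then show ?case by (intro exI[of _ 0] exI[of _ a]) (auto intro: dvdI[of _ _ b])
next
  case (Suc n)
  have q: "q \<noteq> 0" using assms(1) by auto
  have "q dvd a * b" using Suc.prems by simp
  then consider "q dvd a" | "q dvd b"
    using prime_elem_dvd_mult_iff[OF assms(1)] by blast
  then show ?case
  proof cases
    case 1
    then obtain a' where a': "a = q * a'" by blast
    then have "a' * b = q ^ n" using Suc.prems q by (simp add: mult.assoc)
    from Suc.IH[OF this] obtain k u where "u dvd 1" "a' = u * q ^ k" by blast
    then show ?thesis by (intro exI[of _ "Suc k"] exI[of _ u]) (simp add: a' mult_ac)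
  next
    case 2
    then obtain b' where "b = q * b'" by blast
    then have "a * b' = q ^ n" using Suc.prems q by (simp add: mult.left_commute)
    from Suc.IH[OF this] show ?thesis .
  qed
qed

section \<open>Integrality of the reduced norm\<close>

text \<open>Repetitions are allowed, so the F-span of these products is the F-subalgebra F[Z] of K
  generated by \<open>Z\<close>.\<close>

inductive_set monomials :: "'k::comm_monoid_mult set \<Rightarrow> 'k set" for Z where
  one: "1 \<in> monomials Z"
| mult: "z \<in> Z \<Longrightarrow> w \<in> monomials Z \<Longrightarrow> z * w \<in> monomials Z"

context algebraic_derivation
begin

sublocale KF: vector_space "\<lambda>a v. \<iota> a * v"
  by unfold_locales (auto simp: algebra_simps \<iota>.hom_add \<iota>.hom_mult)

lemma span_mult_left:
  assumes "v \<in> KF.span A" and "\<And>w. w \<in> A \<Longrightarrow> z * w \<in> KF.span B"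
  shows "z * v \<in> KF.span B"
  using assms(1)
proof (induction rule: KF.span_induct_alt)
  case base
  show ?case by (simp add: KF.span_zero)
next
  case (step a x y)
  have "z * (\<iota> a * x + y) = \<iota> a * (z * x) + z * y" by (simp add: algebra_simps)
  then show ?case using step assms(2) by (simp add: KF.span_add KF.span_scale)
qed

text \<open>Since $z^p \in F$ for $z \in K$, exponents may be reduced below $p$.\<close>

lemma monomials_finite_span:
  assumes fin: "finite Z"
  shows "\<exists>M. finite M \<and> monomials Z \<subseteq> KF.span M"
proof -
  define mon where "mon \<epsilon> = (\<Prod>z\<in>Z. z ^ \<epsilon> z)" for \<epsilon> :: "'k \<Rightarrow> nat"
  define M where "M = mon ` (Z \<rightarrow>\<^sub>E {..<p})"
  have "finite M"
    unfolding M_def by (intro finite_imageI finite_PiE) (auto simp: fin)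
  have mon_split: "mon \<epsilon> = z ^ \<epsilon> z * (\<Prod>z\<in>Z - {z}. z ^ \<epsilon> z)" if "z \<in> Z" for z \<epsilon>
    unfolding mon_def using fin that by (rule prod.remove)
  have mult_M: "z * w \<in> KF.span M" if z: "z \<in> Z" and w: "w \<in> M" for z w
  proof -
    obtain \<epsilon> where \<epsilon>: "w = mon \<epsilon>" "\<epsilon> \<in> Z \<rightarrow>\<^sub>E {..<p}" using w by (auto simp: M_def)
    define r where "r = (\<Prod>z\<in>Z - {z}. z ^ \<epsilon> z)"
    have upd: "mon (\<epsilon>(z := i)) = z ^ i * r" for i
      unfolding mon_split[OF z] r_def by (auto intro!: arg_cong2[where f = "(*)"] prod.cong)
    have in_M: "mon (\<epsilon>(z := i)) \<in> M" if "i < p" for i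
      unfolding M_def using that \<epsilon>(2) z by (intro imageI) (auto simp: PiE_iff extensional_def)
    have w_eq: "w = z ^ \<epsilon> z * r" by (simp add: \<epsilon>(1) mon_split[OF z] r_def)
    show ?thesis
    proof (cases "Suc (\<epsilon> z) < p")
      case True
      have "z * w = mon (\<epsilon>(z := Suc (\<epsilon> z)))" by (simp add: upd w_eq mult.assoc)
      then show ?thesis using in_M[OF True] by (simp add: KF.span_base)
    next
      case False
      then have "Suc (\<epsilon> z) = p" using \<epsilon>(2) z by (force simp: PiE_iff)
      then have "z * w = z ^ p * mon (\<epsilon>(z := 0))"
        by (simp add: upd w_eq mult.assoc flip: power_Suc)
      moreover obtain b where "z ^ p = \<iota> b" using pth_power by blast
      moreover have "mon (\<epsilon>(z := 0)) \<in> M" using prime_gt_0_nat[OF prime_p] by (rule in_M)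
      ultimately show ?thesis by (simp add: KF.span_base KF.span_scale)
    qed
  qed
  have "w \<in> KF.span M" if "w \<in> monomials Z" for w
    using that
  proof induction
    case one
    have "mon (\<lambda>z\<in>Z. 0) = 1" by (simp add: mon_def)
    moreover have "mon (\<lambda>z\<in>Z. 0) \<in> M"
      unfolding M_def using prime_gt_0_nat[OF prime_p] by (intro imageI) auto
    ultimately show ?case by (simp add: KF.span_base)
  next
    case (mult z w)
    from mult.IH show ?case by (rule span_mult_left) (rule mult_M[OF mult.hyps(1)])
  qed
  with \<open>finite M\<close> show ?thesis by blast
qed

text \<open>By the Leibniz rule \<open>\<delta> (z * w) = z * \<delta> w + \<delta> z * w\<close>,
  and both terms stay in the algebra F[Z] when \<delta> maps \<open>Z\<close> into its own
  span.\<close>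

lemma der_span_monomials:
  assumes Z: "\<And>z. z \<in> Z \<Longrightarrow> \<delta> z \<in> KF.span Z" and "v \<in> KF.span (monomials Z)"
  shows "\<delta> v \<in> KF.span (monomials Z)"
proof -
  let ?V = "KF.span (monomials Z)"
  have mult_Z: "z * v \<in> ?V" if "z \<in> Z" "v \<in> ?V" for z v
    using that(2) by (rule span_mult_left) (auto intro: KF.span_base monomials.mult that(1))
  have mult_span: "v * w \<in> ?V" if "v \<in> KF.span Z" "w \<in> ?V" for v w
  proof -
    have "w * v \<in> ?V"
      using that(1)
    proof (rule span_mult_left)
      show "w * z \<in> ?V" if "z \<in> Z" for z
        using mult_Z[OF that \<open>w \<in> ?V\<close>] by (subst mult.commute)
    qed
    then show ?thesis by (subst mult.commute)
  qed
  have der_mono: "\<delta> w \<in> ?V" if "w \<in> monomials Z" for w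
    using that
  proof induction
    case (mult z w)
    then have "z * \<delta> w \<in> ?V" "\<delta> z * w \<in> ?V"
      by (auto intro: mult_Z mult_span Z KF.span_base)
    then show ?case by (simp add: der_mult KF.span_add)
  qed (simp add: KF.span_zero)
  show ?thesis
    using assms(2)
  proof (induction rule: KF.span_induct_alt)
    case (step a x y)
    then show ?case by (auto simp: der_add der_mult intro: KF.span_add KF.span_scale der_mono)
  qed (simp add: KF.span_zero)
qed

text \<open>The coefficients of \<open>f\<close> and their derivatives of order below
  \<open>n\<close> generate an F-algebra that is stable under \<delta> and, by
  \<open>monomials_finite_span\<close>, finite-dimensional. Left multiplication by \<open>f\<close>
  preserves the polynomials over this algebra, so one finite \<open>M\<close> serves all
  powers.\<close>

lemma coeff_powers_finite_span:
  "\<exists>M. finite M \<and> (\<forall>k i. coeff (((\<star>) f ^^ k) 1) i \<in> KF.span M)"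
proof -
  define Z where "Z = (\<lambda>(i, j). (\<delta> ^^ i) (coeff f j)) ` ({..<n} \<times> {..degree f})"
  let ?V = "KF.span (monomials Z)"
  have "\<delta> z \<in> KF.span Z" if z: "z \<in> Z" for z
  proof -
    obtain i j where ij: "z = (\<delta> ^^ i) (coeff f j)" "i < n" "j \<le> degree f"
      using z by (auto simp: Z_def)
    have mem: "(\<delta> ^^ l) (coeff f j) \<in> KF.span Z" if "l < n" for l
      using that ij(3) by (intro KF.span_base) (auto simp: Z_def)
    show ?thesis
    proof (cases "Suc i < n")
      case True
      then show ?thesis using mem[OF True] ij(1) by simp
    next
      case False
      \<comment> \<open>As g(\<delta>) = 0 and \<open>g\<close> is monic, the derivative of order
        \<open>n\<close> is an F-combination of those of lower order.\<close>
      then have "Suc i = n" using ij by simp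
      have "(\<Sum>l\<le>n. \<iota> (coeff g l) * (\<delta> ^^ l) (coeff f j)) = 0"
        using min_poly by (simp add: is_minimum_polynomial_def poly_operator_def degree_g)
      moreover have "{..n} = insert n {..<n}" by auto
      ultimately have "(\<delta> ^^ n) (coeff f j) = - (\<Sum>l<n. \<iota> (coeff g l) * (\<delta> ^^ l) (coeff f j))"
        by (simp add: lead_coeff_g eq_neg_iff_add_eq_0)
      moreover have "(\<Sum>l<n. \<iota> (coeff g l) * (\<delta> ^^ l) (coeff f j)) \<in> KF.span Z"
        by (intro KF.span_sum KF.span_scale mem) auto
      ultimately have "(\<delta> ^^ Suc i) (coeff f j) \<in> KF.span Z"
        unfolding \<open>Suc i = n\<close> by (simp only: KF.span_neg)
      then show ?thesis using ij(1) by simp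
    qed
  qed
  note der_V = der_span_monomials[OF this]
  have mult_V: "coeff f j * v \<in> ?V" if "v \<in> ?V" for v j
  proof (cases "j \<le> degree f")
    case True
    then have "coeff f j \<in> Z" using n_pos by (auto simp: Z_def intro!: image_eqI[of _ _ "(0, j)"])
    then show ?thesis by (intro span_mult_left[OF that] KF.span_base monomials.mult)
  qed (simp add: coeff_eq_0 KF.span_zero)
  have tm_V: "coeff ((tm ^^ l) y) i \<in> ?V" if "\<And>i. coeff y i \<in> ?V" for y l i
    using that
  proof (induction l arbitrary: i)
    case (Suc l)
    then show ?case
      by (auto simp: coeff_tm KF.span_zero intro!: KF.span_add der_V split: nat.split)
  qed simp
  have "coeff (((\<star>) f ^^ k) 1) i \<in> ?V" for k i
  proof (induction k arbitrary: i)
    case 0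
    show ?case by (auto simp: KF.span_zero KF.span_base monomials.one)
  next
    case (Suc k)
    have "coeff (((\<star>) f ^^ Suc k) 1) i
        = (\<Sum>j\<le>degree f. coeff f j * coeff ((tm ^^ j) (((\<star>) f ^^ k) 1)) i)"
      by (simp add: diff_mult_def[of \<delta> f] coeff_sum)
    also have "\<dots> \<in> ?V"
      by (intro KF.span_sum mult_V tm_V Suc)
    finally show ?case .
  qed
  moreover obtain M where "finite M" "monomials Z \<subseteq> KF.span M"
    using monomials_finite_span[of Z] by (auto simp: Z_def)
  moreover from this have "?V \<subseteq> KF.span M" by (simp add: KF.span_minimal)
  ultimately show ?thesis by blast
qed

section \<open>Expansion over F[x] in finitely many monomials\<close>

text \<open>The generators over F[x] are the monomials with coefficient in \<open>M\<close> and
  exponent below \<open>n\<close>. Their coefficients have degree at most \<open>d / n\<close> in x;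
  the condition is multiplied out by \<open>n\<close>, the degree of x = g(t) in t.\<close>

definition expands :: "'k set \<Rightarrow> nat \<Rightarrow> 'k poly \<Rightarrow> bool" where
  "expands M d y \<longleftrightarrow> (\<exists>b. (\<forall>s\<in>M \<times> {..<n}. n * degree (b s) \<le> d) \<and>
     y = (\<Sum>s\<in>M \<times> {..<n}. ev (b s) \<star> monom (fst s) (snd s)))"

lemma expands_0: "expands M d 0"
  unfolding expands_def by (intro exI[of _ "\<lambda>_. 0"]) auto

lemma expands_mono: "expands M d y \<Longrightarrow> d \<le> d' \<Longrightarrow> expands M d' y"
  unfolding expands_def by (elim exE, rule_tac x = b in exI) (auto intro: order.trans)

lemma expands_add:
  assumes "expands M d y" "expands M d z"
  shows "expands M d (y + z)"
proof -
  from assms obtain a b where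
    "\<forall>s\<in>M \<times> {..<n}. n * degree (a s) \<le> d" "\<forall>s\<in>M \<times> {..<n}. n * degree (b s) \<le> d"
    and eq: "y = (\<Sum>s\<in>M \<times> {..<n}. ev (a s) \<star> monom (fst s) (snd s))"
      "z = (\<Sum>s\<in>M \<times> {..<n}. ev (b s) \<star> monom (fst s) (snd s))"
    unfolding expands_def by blast
  then have deg: "\<forall>s\<in>M \<times> {..<n}. n * max (degree (a s)) (degree (b s)) \<le> d"
    by (auto simp: max_def)
  have "n * degree (a s + b s) \<le> d" if "s \<in> M \<times> {..<n}" for s
    by (rule order.trans[OF mult_le_mono2[OF degree_add_le_max]]) (use deg that in blast)
  then show ?thesis
    unfolding expands_def
    by (intro exI[of _ "\<lambda>s. a s + b s"]) (auto simp: eq ev_add skew_add_left sum.distrib)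
qed

lemma expands_smult:
  assumes "expands M d y"
  shows "expands M d (smult (\<iota> a) y)"
proof -
  from assms obtain b where "\<forall>s\<in>M \<times> {..<n}. n * degree (b s) \<le> d"
    and eq: "y = (\<Sum>s\<in>M \<times> {..<n}. ev (b s) \<star> monom (fst s) (snd s))"
    unfolding expands_def by blast
  then show ?thesis
    unfolding expands_def
    by (intro exI[of _ "\<lambda>s. smult a (b s)"])
      (auto simp: eq ev_smult skew_smult_left smult_sum_right)
qed

lemma expands_sum:
  "(\<And>i. i \<in> A \<Longrightarrow> expands M d (y i)) \<Longrightarrow> expands M d (\<Sum>i\<in>A. y i)"
  by (induction A rule: infinite_finite_induct) (auto simp: expands_0 expands_add)

lemma expands_G:
  assumes "expands M d y"
  shows "expands M (d + n) (G \<star> y)"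
proof -
  from assms obtain b where deg: "\<forall>s\<in>M \<times> {..<n}. n * degree (b s) \<le> d"
    and eq: "y = (\<Sum>s\<in>M \<times> {..<n}. ev (b s) \<star> monom (fst s) (snd s))"
    unfolding expands_def by blast
  have "n * degree (pCons 0 (b s)) \<le> d + n" if "s \<in> M \<times> {..<n}" for s
  proof -
    have "n * degree (pCons 0 (b s)) \<le> n * Suc (degree (b s))"
      by (intro mult_le_mono2 degree_pCons_le)
    then show ?thesis using deg that by fastforce
  qed
  then show ?thesis
    unfolding expands_def
    by (intro exI[of _ "\<lambda>s. pCons 0 (b s)"])
      (auto simp: eq ev_pCons skew_sum_right G_central[symmetric] skew_assoc)
qed

text \<open>Repeated division by the monic \<open>G\<close>: for \<open>d = k + n\<close> the
  monomial is \<open>G \<star> monom u k\<close> up to terms of lower degree, and the factor x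
  accounts for \<open>n\<close> in the bound.\<close>

lemma expands_monom:
  assumes "finite M" "u \<in> M"
  shows "expands M d (monom u d)"
proof (induction d rule: less_induct)
  case (less d)
  show ?case
  proof (cases "d < n")
    case True
    let ?b = "\<lambda>s. if s = (u, d) then 1 else 0 :: 'f poly"
    have "(\<Sum>s\<in>M \<times> {..<n}. ev (?b s) \<star> monom (fst s) (snd s))
        = (\<Sum>s\<in>{(u, d)}. ev (?b s) \<star> monom (fst s) (snd s))"
      by (rule sum.mono_neutral_right) (use assms True in auto)
    then show ?thesis
      unfolding expands_def by (intro exI[of _ ?b]) auto
  next
    case False
    define k where "k = d - n"
    have d: "d = k + n" using False by (simp add: k_def)
    \<comment> \<open>Although \<open>u\<close> may have a nonzero derivative, \<open>G\<close>
      commutes with it, so \<open>u\<close> is moved to the front before \<open>G\<close> is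
      expanded.\<close>
    have "G \<star> monom u k = smult u (G \<star> (tm ^^ k) 1)"
      by (simp add: tm_funpow_one smult_monom flip: G_smult)
    also have "\<dots> = (\<Sum>i\<le>n. smult u (smult (\<iota> (coeff g i)) ((tm ^^ (i + k)) 1)))"
      by (simp add: diff_mult_def degree_G smult_sum_right funpow_add)
    also have "\<dots> = (\<Sum>i\<le>n. smult (\<iota> (coeff g i)) (monom u (i + k)))"
      by (simp add: tm_funpow_one smult_monom mult.commute)
    also have "{..n} = insert n {..<n}" by auto
    finally have "monom u d
        = G \<star> monom u k + (\<Sum>i<n. smult (\<iota> (- coeff g i)) (monom u (i + k)))"
      by (simp add: d lead_coeff_g \<iota>.hom_uminus sum_negf add.commute)
    also have "expands M d \<dots>"
    proof (intro expands_add expands_sum expands_smult)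
      show "expands M d (G \<star> monom u k)"
        unfolding d using less.IH[of k] n_pos by (intro expands_G) (auto simp: d)
      show "expands M d (monom u (i + k))" if "i \<in> {..<n}" for i
        using less.IH[of "i + k"] that by (auto simp: d intro: expands_mono)
    qed
    finally show ?thesis .
  qed
qed

lemma expands_of_coeffs:
  assumes "finite M" and "\<And>i. coeff y i \<in> KF.span M" and "degree y \<le> d"
  shows "expands M d y"
proof -
  have *: "expands M j (monom v j)" if "v \<in> KF.span M" for v j
    using that
  proof (induction rule: KF.span_induct_alt)
    case (step a x v)
    have "monom (\<iota> a * x + v) j = smult (\<iota> a) (monom x j) + monom v j"
      by (simp add: smult_monom add_monom)
    with step show ?case by (simp add: expands_add expands_smult expands_monom[OF assms(1)])
  qed (simp add: expands_0)
  have "expands M d (\<Sum>j\<le>degree y. monom (coeff y j) j)"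
    using assms(3) by (intro expands_sum expands_mono[OF *[OF assms(2)]]) simp
  then show ?thesis by (simp add: poly_as_sum_of_monoms)
qed

text \<open>The matrices of the generators do not depend on \<open>k\<close>, and the k-th power of
  \<open>f\<close> has coefficients of degree at most \<open>k * degree f / n\<close> in x. A
  determinant of size \<open>n\<close> multiplies \<open>n\<close> of them, which gives the bound
  \<open>k * degree f\<close> needed for \<open>z ^ k\<close>.\<close>

lemma det_polynomial:
  fixes \<psi> :: "'k poly \<Rightarrow> 'f poly fract alg_closure mat"
  assumes carrier: "\<And>y. \<psi> y \<in> carrier_mat n n"
    and add: "\<And>y z. \<psi> (y + z) = \<psi> y + \<psi> z"
    and mult: "\<And>y z. \<psi> (y \<star> z) = \<psi> y * \<psi> z"
    and scalar: "\<And>a. \<psi> (ev a) = emb a \<cdot>\<^sub>m 1\<^sub>m n"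
    and det: "det (\<psi> f) = to_ac z"
  shows "\<exists>P. z = to_fract P \<and> degree P \<le> degree f"
proof -
  obtain M where M: "finite M" "\<And>k i. coeff (((\<star>) f ^^ k) 1) i \<in> KF.span M"
    using coeff_powers_finite_span by blast
  let ?S = "M \<times> {..<n}"
  have fin_S: "finite ?S" using M by simp
  have one: "\<psi> 1 = 1\<^sub>m n"
    using scalar[of 1] by (auto intro!: eq_matI)
  have "\<psi> 0 = 0 \<cdot>\<^sub>m 1\<^sub>m n"
    using scalar[of 0] by simp
  then have entry_sum: "\<psi> (\<Sum>s\<in>A. h s) $$ (i, j) = (\<Sum>s\<in>A. \<psi> (h s) $$ (i, j))"
    if "i < n" "j < n" for A :: "('k \<times> nat) set" and h i j
    using that carrier
    by (induction A rule: infinite_finite_induct) (auto simp: add carrier_matD[OF carrier])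
  have entry_ev: "\<psi> (ev a \<star> w) $$ (i, j) = emb a * \<psi> w $$ (i, j)" if "i < n" "j < n" for a w i j
    using that carrier[of w] by (simp add: mult scalar)
  have det_pow: "det (\<psi> (((\<star>) f ^^ k) 1)) = to_ac (z ^ k)" for k
    by (induction k) (simp_all add: one mult det_mult[OF carrier carrier] det)
  have deg_pow: "degree (((\<star>) f ^^ k) 1) \<le> k * degree f" for k
  proof (induction k)
    case (Suc k)
    have "degree (((\<star>) f ^^ Suc k) 1) \<le> degree f + degree (((\<star>) f ^^ k) 1)"
      by (simp add: degree_skew_mult_le)
    with Suc show ?case by simp
  qed simp
  obtain Q :: "((nat \<Rightarrow> nat) \<times> (nat \<Rightarrow> 'k \<times> nat)) set" and l where fin_Q: "finite Q"
    and Q: "\<And>b Y d. Y \<in> carrier_mat n n \<Longrightarrow>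
       (\<forall>i<n. \<forall>j<n. Y $$ (i, j)
         = (\<Sum>s\<in>?S. emb (b s) * \<psi> (monom (fst s) (snd s)) $$ (i, j))) \<Longrightarrow>
       (\<forall>s\<in>?S. n * degree (b s) \<le> d) \<Longrightarrow>
       \<exists>C. det Y = (\<Sum>q\<in>Q. emb (C q) * l q) \<and> (\<forall>q\<in>Q. degree (C q) \<le> d)"
    using det_linear_combination
      [OF fin_S, of n "\<lambda>s i j. \<psi> (monom (fst s) (snd s)) $$ (i, j)"] by blast
  have "\<exists>C. to_ac (z ^ k) = (\<Sum>q\<in>Q. emb (C q) * l q) \<and> (\<forall>q\<in>Q. degree (C q) \<le> k * degree f)" for k
  proof -
    have "expands M (k * degree f) (((\<star>) f ^^ k) 1)"
      by (intro expands_of_coeffs M deg_pow)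
    then obtain b where b: "\<forall>s\<in>?S. n * degree (b s) \<le> k * degree f"
      "((\<star>) f ^^ k) 1 = (\<Sum>s\<in>?S. ev (b s) \<star> monom (fst s) (snd s))"
      unfolding expands_def by blast
    show ?thesis
      unfolding det_pow[symmetric]
      by (rule Q[OF carrier _ b(1)]) (simp add: b(2) entry_sum entry_ev)
  qed
  then have "\<exists>C. \<forall>k. to_ac (z ^ k) = (\<Sum>q\<in>Q. emb (C k q) * l q) \<and>
      (\<forall>q\<in>Q. degree (C k q) \<le> k * degree f)"
    by (intro choice allI)
  then obtain C where C: "\<And>k. to_ac (z ^ k) = (\<Sum>q\<in>Q. emb (C k q) * l q)"
    "\<And>k q. q \<in> Q \<Longrightarrow> degree (C k q) \<le> k * degree f"
    by blast
  show ?thesis by (rule polynomial_of_bounded_powers[OF fin_Q C])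
qed

end

section \<open>The reduced norm on $K[t;\delta]$\<close>

context algebraic_derivation
begin

abbreviation frac :: "'k poly \<Rightarrow> 'f poly \<Rightarrow> ('k poly \<times> 'f poly) set" where
  "frac \<equiv> cq_frac \<delta> \<iota> g"

abbreviation CQ :: "('k poly \<times> 'f poly) set ring" where "CQ \<equiv> central_quotients \<delta> \<iota> g"

lemma mem_frac: "(h, r) \<in> frac f q \<longleftrightarrow> q \<noteq> 0 \<and> r \<noteq> 0 \<and> f \<star> ev r = h \<star> ev q"
  by (auto simp: cq_frac_def cq_rel_def)

lemma frac_cancel:
  assumes "q \<noteq> 0"
  shows "frac (f \<star> ev q) q = frac f 1"
proof -
  have "f \<star> ev q \<star> ev r = f \<star> ev r \<star> ev q" for r
    by (metis skew_assoc ev_central)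
  then have "(h, r) \<in> frac (f \<star> ev q) q \<longleftrightarrow> (h, r) \<in> frac f 1" for h r
    using assms by (simp add: mem_frac skew_right_cancel)
  then show ?thesis by auto
qed

lemma mem_frac_1: "x \<in> frac f 1 \<longleftrightarrow> (\<exists>r. r \<noteq> 0 \<and> x = (f \<star> ev r, r))"
  by (cases x) (auto simp: mem_frac)

lemma frac_1_nonempty: "frac f 1 \<noteq> {}"
  using mem_frac_1[of "(f, 1)" f] by (auto intro: exI[of _ 1])

text \<open>The representatives of f/1 are exactly the pairs \<open>(f \<star> ev r, r)\<close>.
  Central factors cancel, so all members of the defining union are the same class, and the union
  equals it because its index sets are nonempty.\<close>

lemma frac_mult: "frac f 1 \<otimes>\<^bsub>CQ\<^esub> frac f' 1 = frac (f \<star> f') 1"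
proof -
  have "frac (fst x \<star> fst y) (snd x * snd y) = frac (f \<star> f') 1"
    if xy: "x \<in> frac f 1" "y \<in> frac f' 1" for x y
  proof -
    obtain r r' where r: "r \<noteq> 0" "r' \<noteq> 0" "x = (f \<star> ev r, r)" "y = (f' \<star> ev r', r')"
      using xy by (auto simp: mem_frac_1)
    have "f \<star> ev r \<star> (f' \<star> ev r') = f \<star> f' \<star> ev (r * r')"
      by (metis ev_central ev_mult skew_assoc)
    then show ?thesis using r by (simp add: frac_cancel)
  qed
  then show ?thesis
    using frac_1_nonempty by (auto simp: central_quotients_def case_prod_unfold)
qed

lemma frac_add: "frac f 1 \<oplus>\<^bsub>CQ\<^esub> frac f' 1 = frac (f + f') 1"
proof -
  have "frac (fst x \<star> ev (snd y) + fst y \<star> ev (snd x)) (snd x * snd y) = frac (f + f') 1"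
    if xy: "x \<in> frac f 1" "y \<in> frac f' 1" for x y
  proof -
    obtain r r' where r: "r \<noteq> 0" "r' \<noteq> 0" "x = (f \<star> ev r, r)" "y = (f' \<star> ev r', r')"
      using xy by (auto simp: mem_frac_1)
    have "f \<star> ev r \<star> ev r' + f' \<star> ev r' \<star> ev r = (f + f') \<star> ev (r * r')"
      by (simp add: skew_add_left ev_mult skew_assoc ev_central[of r'])
    then show ?thesis using r by (simp add: frac_cancel)
  qed
  then show ?thesis
    using frac_1_nonempty by (auto simp: central_quotients_def case_prod_unfold)
qed

lemma cq_scalar_to_fract: "cq_scalar \<delta> \<iota> g (to_fract a) = frac (ev a) 1"
proof -
  let ?R = "{(a', b). b \<noteq> 0 \<and> to_fract a = Fraction_Field.Fract a' b}"
  have const: "frac (ev a') b = frac (ev a) 1" if "b \<noteq> 0" "to_fract a = Fraction_Field.Fract a' b" for a' b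
  proof -
    have "a' = a * b" using that by (simp add: to_fract_def eq_fract)
    then show ?thesis using that by (simp add: ev_mult frac_cancel)
  qed
  have "(a, 1) \<in> ?R" by (simp add: to_fract_def)
  then have "?R \<noteq> {}" by blast
  moreover have "cq_scalar \<delta> \<iota> g (to_fract a) = (\<Union>x\<in>?R. frac (ev a) 1)"
    unfolding cq_scalar_def by (rule SUP_cong) (auto simp: const)
  ultimately show ?thesis by (simp only: UN_constant if_False)
qed

lemma frac_in_carrier: "frac f 1 \<in> carrier CQ"
proof -
  have "\<exists>f' q. frac f 1 = frac f' q \<and> q \<noteq> 0"
    by (rule exI[of _ f], rule exI[of _ 1]) simp
  then show ?thesis by (simp add: central_quotients_def)
qed

text \<open>A splitting restricts along \<open>f \<mapsto> frac f 1\<close> to a matrix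
  representation \<open>\<psi>\<close> of R, to which \<open>det_polynomial\<close> applies. The
  image of \<open>ev a\<close> is a scalar matrix of size \<open>n\<close>, whence the power
  \<open>a ^ n\<close>. Injectivity of \<open>emb\<close> carries the identities back to
  F[x].\<close>

lemma reduced_norm_polynomial:
  assumes "is_reduced_norm CQ (cq_scalar \<delta> \<iota> g) n N"
  obtains \<nu> where "\<And>f. N (frac f 1) = to_fract (\<nu> f)" "\<And>f. degree (\<nu> f) \<le> degree f"
    "\<And>f f'. \<nu> (f \<star> f') = \<nu> f * \<nu> f'" "\<And>a. \<nu> (ev a) = a ^ n"
proof -
  obtain \<phi> where \<phi>: "is_splitting CQ (cq_scalar \<delta> \<iota> g) n \<phi>"
    and N: "\<And>A. A \<in> carrier CQ \<Longrightarrow> det (\<phi> A) = to_ac (N A)"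
    using assms by (auto simp: is_reduced_norm_def)
  define \<psi> where "\<psi> f = \<phi> (frac f 1)" for f
  have hom: "\<phi> \<in> Ring.ring_hom CQ (ring_mat TYPE('f poly fract alg_closure) n ())"
    and scal: "\<And>z. \<phi> (cq_scalar \<delta> \<iota> g z) = to_ac z \<cdot>\<^sub>m 1\<^sub>m n"
    using \<phi> by (auto simp: is_splitting_def)
  have carrier: "\<psi> f \<in> carrier_mat n n" for f
    using ring_hom_closed[OF hom frac_in_carrier] by (simp add: \<psi>_def ring_mat_def)
  have add: "\<psi> (y + z) = \<psi> y + \<psi> z" for y z
    using ring_hom_add[OF hom frac_in_carrier frac_in_carrier, of y z]
    by (simp add: \<psi>_def frac_add ring_mat_def)
  have mult: "\<psi> (y \<star> z) = \<psi> y * \<psi> z" for y z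
    using ring_hom_mult[OF hom frac_in_carrier frac_in_carrier, of y z]
    by (simp add: \<psi>_def frac_mult ring_mat_def)
  have scalar: "\<psi> (ev a) = emb a \<cdot>\<^sub>m 1\<^sub>m n" for a
    using scal[of "to_fract a"] by (simp add: \<psi>_def cq_scalar_to_fract emb_def)
  have det: "det (\<psi> f) = to_ac (N (frac f 1))" for f
    unfolding \<psi>_def by (rule N) (rule frac_in_carrier)
  have "\<exists>P. N (frac f 1) = to_fract P \<and> degree P \<le> degree f" for f
    by (rule det_polynomial[OF carrier add mult scalar det])
  then obtain \<nu> where \<nu>: "\<And>f. N (frac f 1) = to_fract (\<nu> f)" "\<And>f. degree (\<nu> f) \<le> degree f"
    by metis
  have det_\<nu>: "det (\<psi> f) = emb (\<nu> f)" for f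
    by (simp add: det \<nu> emb_def)
  have "emb (\<nu> (f \<star> f')) = emb (\<nu> f * \<nu> f')" for f f'
    by (simp add: mult det_mult[OF carrier carrier] flip: det_\<nu>)
  moreover have "emb (\<nu> (ev a)) = emb (a ^ n)" for a
  proof -
    have "emb (a ^ k) = emb a ^ k" for k by (induction k) auto
    then show ?thesis by (simp add: scalar flip: det_\<nu>)
  qed
  ultimately show ?thesis using that[of \<nu>] \<nu> by (simp only: emb_simps(5))
qed

section \<open>Norms and factorizations\<close>

text \<open>The degree of \<open>hhat ^ n\<close> is
  \<open>n * degree f = degree q + degree f\<close>, so the degree bounds for \<open>\<nu> q\<close>
  and \<open>\<nu> f\<close> are both attained. A divisor of \<open>hhat ^ n\<close> is a unit times
  a power of \<open>hhat\<close>, and comparing degrees gives exponent 1.\<close>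

lemma norm_irreducible:
  assumes deg: "\<And>f. degree (\<nu> f) \<le> degree f"
    and mult: "\<And>f f'. \<nu> (f \<star> f') = \<nu> f * \<nu> f'" and ev: "\<And>a. \<nu> (ev a) = a ^ n"
    and h: "ev hhat = q \<star> f" and deg_hhat: "degree hhat = degree f" and irr: "irreducible hhat"
  shows "irreducible (\<nu> f)" and "degree (\<nu> f) = degree f"
proof -
  have nz: "hhat \<noteq> 0" and not_unit: "\<not> hhat dvd 1"
    using irr by (auto simp: irreducible_def)
  then have m: "degree f > 0" using deg_hhat by (simp add: is_unit_iff_degree)
  have \<nu>_eq: "\<nu> f * \<nu> q = hhat ^ n"
    using mult[of q f] by (simp add: ev mult.commute flip: h)
  then have \<nu>_nz: "\<nu> f \<noteq> 0" "\<nu> q \<noteq> 0" using nz by auto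
  have qf: "q \<noteq> 0" "f \<noteq> 0" using h nz by (metis ev_eq_0_iff skew_0_left skew_0_right)+
  have "degree (\<nu> f) + degree (\<nu> q) = n * degree f"
    using arg_cong[OF \<nu>_eq, of degree] \<nu>_nz nz deg_hhat
    by (simp add: degree_mult_eq degree_power_eq)
  moreover have "degree q + degree f = n * degree f"
    using degree_ev[OF nz] deg_hhat degree_skew_mult[OF qf] h by simp
  ultimately show deg_eq: "degree (\<nu> f) = degree f"
    using deg[of f] deg[of q] by linarith
  obtain k u where u: "u dvd 1" "\<nu> f = u * hhat ^ k"
    using prime_elem_power_factor[OF field_poly_irreducible_imp_prime[OF irr] \<nu>_eq] by blast
  have "u \<noteq> 0" using \<nu>_nz u by auto
  then have "degree f = k * degree f"
    using u nz deg_hhat deg_eq by (auto simp: degree_mult_eq degree_power_eq is_unit_iff_degree)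
  then have "k = 1" using m by simp
  then show "irreducible (\<nu> f)" using u irr by (simp add: irreducible_mult_unit_left)
qed

text \<open>The degree bound is attained for \<open>\<nu> f\<close>, hence also for the norms of the
  factors in \<open>f = a \<star> b\<close>. Nonconstant factors then have nonconstant norms,
  against the irreducibility of \<open>\<nu> f\<close>.\<close>

lemma diff_irreducible_if_irreducible:
  assumes deg: "\<And>f. degree (\<nu> f) \<le> degree f"
    and mult: "\<And>f f'. \<nu> (f \<star> f') = \<nu> f * \<nu> f'" and ev: "\<And>a. \<nu> (ev a) = a ^ n"
    and h: "ev hhat = q \<star> f" and deg_hhat: "degree hhat = degree f" and irr: "irreducible hhat"
  shows "diff_irreducible \<delta> f"
proof -
  have \<nu>_irr: "irreducible (\<nu> f)" and \<nu>_deg: "degree (\<nu> f) = degree f"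
    by (rule norm_irreducible[OF deg mult ev h deg_hhat irr])+
  then have \<nu>_nz: "\<nu> f \<noteq> 0" and m: "degree f > 0"
    by (auto simp: irreducible_def is_unit_iff_degree)
  have False if f: "f = a \<star> b" and ab: "1 \<le> degree a" "1 \<le> degree b" for a b
  proof -
    have nz: "a \<noteq> 0" "b \<noteq> 0" "\<nu> a \<noteq> 0" "\<nu> b \<noteq> 0"
      using ab \<nu>_nz by (auto simp: f mult)
    have "degree (\<nu> a) + degree (\<nu> b) = degree a + degree b"
      using \<nu>_deg nz by (simp add: f mult degree_mult_eq degree_skew_mult)
    then have "degree (\<nu> a) > 0" "degree (\<nu> b) > 0"
      using deg[of a] deg[of b] ab by linarith+
    then have "\<not> \<nu> a dvd 1" "\<not> \<nu> b dvd 1" using nz by (auto simp: is_unit_iff_degree)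
    then show False using irreducibleD[OF \<nu>_irr] by (auto simp: f mult)
  qed
  then show ?thesis
    using m by (auto simp: diff_irreducible_def Units_iff)
qed

section \<open>Irreducibility of the minimal central left multiple\<close>

text \<open>Take for \<open>d\<close> a nonzero element of least degree in the left ideal Ra + Rf.
  The remainder of any element of the ideal modulo \<open>d\<close> lies in the ideal again and
  therefore vanishes.\<close>

lemma left_ideal_principal:
  assumes "f \<noteq> 0"
  shows "\<exists>d u v. d = u \<star> a + v \<star> f \<and> (\<exists>q. f = q \<star> d) \<and> (\<exists>q. a = q \<star> d)"
proof -
  define J where "J d \<longleftrightarrow> d \<noteq> 0 \<and> (\<exists>u v. d = u \<star> a + v \<star> f)" for d
  have "J f" using assms by (simp add: J_def) (metis add_0 skew_0_left skew_1_left)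
  then obtain d where "J d" and min: "\<And>r. J r \<Longrightarrow> degree d \<le> degree r"
    using ex_has_least_nat[of J f degree] by blast
  then obtain u v where d: "d \<noteq> 0" "d = u \<star> a + v \<star> f" by (auto simp: J_def)
  have "\<exists>q. y = q \<star> d" if y: "y = s \<star> a + t \<star> f" for y s t
  proof -
    obtain q r where qr: "y = q \<star> d + r" "r = 0 \<or> degree r < degree d"
      using right_division[OF d(1)] by blast
    have "q \<star> d = (q \<star> u) \<star> a + (q \<star> v) \<star> f"
      by (simp add: d(2) skew_add_right skew_assoc)
    then have "r = (s - q \<star> u) \<star> a + (t - q \<star> v) \<star> f"
      using qr(1) y by (simp add: skew_diff_left algebra_simps)
    then have "r = 0 \<or> J r" unfolding J_def by blast
    then have "r = 0" using min[of r] qr(2) by auto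
    with qr show ?thesis by auto
  qed
  from this[of f 0 1] this[of a 1 0] d(2) show ?thesis by auto
qed

text \<open>If \<open>hhat = a * b\<close> with nonunits, the generator \<open>d\<close> of the left
  ideal of \<open>ev a\<close> and \<open>f\<close> right-divides \<open>f\<close>, so
  \<open>d\<close> is a unit or differs from \<open>f\<close> by a unit. Then \<open>f\<close>
  right-divides \<open>ev b\<close> or \<open>ev a\<close>, and both have smaller degree than
  \<open>ev hhat\<close>.\<close>

lemma irreducible_if_diff_irreducible:
  assumes irr: "diff_irreducible \<delta> f" and f: "f \<noteq> 0"
    and min: "is_min_central_left_multiple \<delta> f (ev hhat)"
    and deg_hhat: "degree hhat = degree f"
  shows "irreducible hhat"
proof -
  obtain q where q: "ev hhat = q \<star> f" and nz: "hhat \<noteq> 0"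
    using min by (auto simp: is_min_central_left_multiple_def Let_def)
  \<comment> \<open>Every \<open>ev a\<close> is central, so it competes with
    \<open>ev hhat\<close>. Dividing degrees in t by \<open>n\<close> turns minimality into a
    statement about degrees in x.\<close>
  have minimal: "degree hhat \<le> degree a" if "a \<noteq> 0" "ev a = r \<star> f" for a r
  proof -
    have "degree (ev hhat) \<le> degree (ev a)"
      using min that ev_central[of a] ev_eq_0_iff[of a]
      unfolding is_min_central_left_multiple_def Let_def diff_poly_ring_simps in_center_iff
      by blast
    then show ?thesis using degree_ev[OF nz] degree_ev[OF that(1)] n_pos by auto
  qed
  have m: "degree f > 0"
    using irr f by (auto simp: diff_irreducible_def Units_iff)
  show ?thesis
  proof (rule irreducibleI)
    show "hhat \<noteq> 0" by (fact nz)
    show "\<not> hhat dvd 1" using m nz deg_hhat by (simp add: is_unit_iff_degree)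
    fix a b assume ab: "hhat = a * b"
    then have abz: "a \<noteq> 0" "b \<noteq> 0" using nz by auto
    show "a dvd 1 \<or> b dvd 1"
    proof (rule ccontr)
      assume "\<not> (a dvd 1 \<or> b dvd 1)"
      then have "degree a > 0" "degree b > 0" using abz by (auto simp: is_unit_iff_degree)
      then have lt: "degree a < degree hhat" "degree b < degree hhat"
        using ab abz by (auto simp: degree_mult_eq)
      obtain d u v s r where d: "d = u \<star> ev a + v \<star> f" "f = s \<star> d" "ev a = r \<star> d"
        using left_ideal_principal[OF f] by blast
      have sd: "s \<noteq> 0" "d \<noteq> 0" using d(2) f by auto
      then have "degree f = degree s + degree d" using d(2) degree_skew_mult by metis
      moreover have "\<not> (1 \<le> degree s \<and> degree s < degree f \<and> 1 \<le> degree d \<and> degree d < degree f)"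
        using irr d(2) by (auto simp: diff_irreducible_def)
      ultimately consider "degree s = 0" | "degree d = 0" by linarith
      then show False
      proof cases
        case 1
        then have "s \<in> Units (diff_poly_ring \<delta>)" using sd by (simp add: Units_iff)
        then obtain s' where "s' \<star> s = 1" by (auto simp: Units_def)
        then have "ev a = (r \<star> s') \<star> f" by (metis d(2,3) skew_1_left skew_assoc)
        from minimal[OF abz(1) this] lt show False by simp
      next
        case 2
        then have "d \<in> Units (diff_poly_ring \<delta>)" using sd by (simp add: Units_iff)
        then obtain d' where "d' \<star> d = 1" by (auto simp: Units_def)
        \<comment> \<open>Multiplying \<open>1 = d' \<star> d\<close> by the central
          \<open>ev b\<close> turns the summand with \<open>ev a\<close> into a left multiple of
          \<open>ev (a * b) = q \<star> f\<close>, so \<open>f\<close> right-divides the whole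
          sum.\<close>
        then have "ev b = ev b \<star> (d' \<star> (u \<star> ev a + v \<star> f))" by (simp flip: d(1))
        also have "\<dots> = d' \<star> (u \<star> (ev a \<star> ev b)) + d' \<star> (ev b \<star> (v \<star> f))"
          by (simp add: skew_add_right skew_assoc ev_central[of b])
        also have "\<dots> = (d' \<star> (u \<star> q) + d' \<star> (ev b \<star> v)) \<star> f"
          by (simp add: skew_add_left skew_assoc flip: ev_mult ab q)
        finally show False using minimal[OF abz(2)] lt by (metis not_le)
      qed
    qed
  qed
qed

end

theorem theorem22:
  fixes p e m :: nat
    and \<iota> :: "'f::field \<Rightarrow> 'k::field"
    and \<delta> :: "'k \<Rightarrow> 'k"
    and c :: "nat \<Rightarrow> 'f"
    and g hhat :: "'f poly"
    and f h :: "'k poly"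
    and N :: "('k poly \<times> 'f poly) set \<Rightarrow> 'f poly fract"
  assumes "prime p" and "CHAR('f) = p"
    and "field_hom \<iota>" and "purely_inseparable_exponent p \<iota> 1"
    and "derivation \<delta>" and "Const \<delta> = range \<iota>"
    and "g = Polynomial.monom 1 (p ^ e) + (\<Sum>i=1..e. Polynomial.monom (c i) (p ^ (e - i)))"
    and "is_minimum_polynomial \<delta> \<iota> g"
    and "is_reduced_norm (central_quotients \<delta> \<iota> g) (cq_scalar \<delta> \<iota> g) (p ^ e) N"
    and "f \<noteq> 0" and "Polynomial.degree f = m"
    and "is_min_central_left_multiple \<delta> f h"
    and "h = at_g \<delta> \<iota> g hhat" and "lead_coeff hhat = 1"
    and "Polynomial.degree hhat = m"
  shows "(Factorial_Ring.irreducible hhat \<longrightarrow> diff_irreducible \<delta> f) \<and>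
         (diff_irreducible \<delta> f \<longrightarrow>
            (\<exists>P::'f poly. N (cq_frac \<delta> \<iota> g f 1) = to_fract P \<and> Factorial_Ring.irreducible P))"
proof -
  have pth_power: "a ^ p \<in> range \<iota>" for a
    using assms(4) by (simp add: purely_inseparable_exponent_def)
  interpret algebraic_derivation \<delta> \<iota> p e c g
    by (rule algebraic_derivation.intro[OF derivation_ring.intro algebraic_derivation_axioms.intro])
      (fact assms pth_power)+
  obtain \<nu> where \<nu>: "\<And>f. N (frac f 1) = to_fract (\<nu> f)" "\<And>f. degree (\<nu> f) \<le> degree f"
    "\<And>f f'. \<nu> (f \<star> f') = \<nu> f * \<nu> f'" "\<And>a. \<nu> (ev a) = a ^ n"
    by (rule reduced_norm_polynomial[OF assms(9)]) blast
  obtain q where q: "ev hhat = q \<star> f"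
    using assms(12,13) by (auto simp: is_min_central_left_multiple_def Let_def)
  have deg: "degree hhat = degree f" using assms(11,15) by simp
  show ?thesis
  proof (intro conjI impI)
    assume "irreducible hhat"
    then show "diff_irreducible \<delta> f"
      by (rule diff_irreducible_if_irreducible[OF \<nu>(2-4) q deg])
  next
    assume "diff_irreducible \<delta> f"
    \<comment> \<open>Part (ii) passes through \<open>hhat\<close>: once it is known to be
      irreducible, the norm argument behind part (i) applies.\<close>
    then have "irreducible hhat"
      using assms(10,12,13) deg by (intro irreducible_if_diff_irreducible) auto
    then have "irreducible (\<nu> f)"
      by (rule norm_irreducible(1)[OF \<nu>(2-4) q deg])
    with \<nu>(1) show "\<exists>P. N (cq_frac \<delta> \<iota> g f 1) = to_fract P \<and> irreducible P" by blast
  qed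
qed

end
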